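(* Let $\Gamma=(G,\sigma)$ be a signed graph with $G=(V,E)$, $|V|=n$, and let $\mathcal G$ be the set of all subgraphs of $\Gamma$; for $\Gamma_0\in\mathcal G$ let $|V_{\Gamma_0}|$ be its number of vertices. For $1\le k\le n$, $$L_k(\Gamma)\ \ge\ \frac12\max_{\substack{\Gamma_0\in\mathcal G\\ |V_{\Gamma_0}|\ge n-k+1}}\lambda_{|V_{\Gamma_0}|-n+k}(A^\mu_{-\Gamma_0})\ =\ \frac12\max_{\substack{\Gamma_0\in\mathcal G\\ |V_{\Gamma_0}|=n}}\lambda_k(A^\mu_{-\Gamma_0}).$$ For $k=n$ the inequality is an equality, and moreover $$L_n(\Gamma)=\frac12\max_{\substack{\Gamma_0\in\mathcal G,\ |V_{\Gamma_0}|=n\\ \Gamma_0\text{ antibalanced}}}\lambda_n(A^\mu_{-\Gamma_0}).$$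
   Context: $G=(V,E)$ is a finite undirected graph without self-loops, $V=\{1,\dots,n\}$. A signed graph $\Gamma=(G,\sigma)$ has signature $\sigma:E\to\{\pm1\}$, $\sigma_{ij}=\sigma(\{i,j\})$, edge weight $w:E\to(0,\infty)$, vertex measure $\mu:V\to(0,\infty)$, potential $\kappa:V\to\mathbb R$. A subgraph $\Gamma_0=(G_0,\sigma)$ of $\Gamma$ has $G_0=(V_0,E_0)$ with $V_0\subset V$, $E_0\subset E$ consisting of edges with both endpoints in $V_0$, and carries the restrictions of $\sigma,w,\mu,\kappa$. $-\Gamma=(G,-\sigma)$. The adjacency matrix $A_\Gamma$ has entries $a_{ij}=\sigma_{ij}w_{ij}$ if $i\sim j$ and $0$ otherwise; the normalized adjacency matrix is $A^\mu_\Gamma=D^{-1}A_\Gamma$, $D=\mathrm{diag}(\mu_1,\dots,\mu_n)$; its eigenvalues (real) are ordered $\lambda_1\le\dots\le\lambda_n$. A switching function $\tau:V\to\{\pm1\}$ changes $\sigma$ to $\sigma^\tau_{ij}=\tau(i)\sigma_{ij}\tau(j)$; $\Gamma$ is antibalanced if $\sigma^\tau\equiv-1$ for some $\tau$. For $p\ge1$ and nonzero $f$, $\mathcal R_p^\sigma(f)=\frac{\sum_{\{i,j\}\in E}w_{ij}|f(i)-\sigma_{ij}f(j)|^p+\sum_i\kappa_i|f(i)|^p}{\sum_i\mu_i|f(i)|^p}$; $\mathcal S_p=\{f:\sum_i\mu_i|f(i)|^p=1\}$; the Krasnoselskii genus $\gamma(B)$ of a closed symmetric $B\subset\mathbb R^n\setminus\{0\}$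 is the least $k$ with an odd continuous map $B\to\mathbb R^k\setminus\{0\}$; $\mathcal F_k(\mathcal S_p)$ = closed symmetric $B\subset\mathcal S_p$ with $\gamma(B)\ge k$; $\lambda_k^{(p)}(\Gamma)=\min_{B\in\mathcal F_k(\mathcal S_p)}\max_{f\in B}\mathcal R_p^\sigma(f)$. Cut-off adjacency eigenvalues: $L_k(\Gamma):=\lim_{p\to\infty}2^{-p}\lambda_k^{(p)}(\Gamma)$ (limits exist, independent of $\kappa$). *)

theory Defs
  imports "HOL-Analysis.Analysis" "Jordan_Normal_Form.Char_Poly"
begin

definition signed_graph :: "nat \<Rightarrow> nat set set \<Rightarrow> (nat set \<Rightarrow> real) \<Rightarrow> (nat set \<Rightarrow> real)
    \<Rightarrow> (nat \<Rightarrow> real) \<Rightarrow> bool" where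
  "signed_graph n E sg w mu \<longleftrightarrow>
     (\<forall>e\<in>E. \<exists>i j. e = {i, j} \<and> i \<noteq> j \<and> i < n \<and> j < n) \<and>
     (\<forall>e\<in>E. sg e = 1 \<or> sg e = -1) \<and>
     (\<forall>e\<in>E. w e > 0) \<and>
     (\<forall>i<n. mu i > 0)"

text \<open>Functions on V are vectors in R^n, represented as nat \<Rightarrow> real vanishing outside {..<n}
  (with the product topology, which on this subspace is the Euclidean one).\<close>

definition rvec :: "nat \<Rightarrow> (nat \<Rightarrow> real) set" where
  "rvec n = {f. \<forall>i\<ge>n. f i = 0}"

definition odd_map_into :: "(nat \<Rightarrow> real) set \<Rightarrow> nat \<Rightarrow> bool" where
  "odd_map_into B k \<longleftrightarrow> (\<exists>h :: (nat \<Rightarrow> real) \<Rightarrow> (nat \<Rightarrow> real).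
      continuous_on B h \<and> (\<forall>f\<in>B. h (\<lambda>i. - f i) = (\<lambda>i. - h f i)) \<and> h ` B \<subseteq> rvec k - {\<lambda>_. 0})"

definition genus :: "(nat \<Rightarrow> real) set \<Rightarrow> nat" where
  "genus B = (LEAST k. odd_map_into B k)"

text \<open>p-Rayleigh quotient; the edge term is symmetric in the two endpoints since sg = \<plusminus>1.\<close>

definition rayleigh_p :: "nat \<Rightarrow> nat set set \<Rightarrow> (nat set \<Rightarrow> real) \<Rightarrow> (nat set \<Rightarrow> real)
    \<Rightarrow> (nat \<Rightarrow> real) \<Rightarrow> (nat \<Rightarrow> real) \<Rightarrow> real \<Rightarrow> (nat \<Rightarrow> real) \<Rightarrow> real" where
  "rayleigh_p n E sg w mu kappa p f =
     ((\<Sum>e\<in>E. w e * \<bar>f (Min e) - sg e * f (Max e)\<bar> powr p)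
       + (\<Sum>i<n. kappa i * \<bar>f i\<bar> powr p))
     / (\<Sum>i<n. mu i * \<bar>f i\<bar> powr p)"

definition sphere_p :: "nat \<Rightarrow> (nat \<Rightarrow> real) \<Rightarrow> real \<Rightarrow> (nat \<Rightarrow> real) set" where
  "sphere_p n mu p = {f \<in> rvec n. (\<Sum>i<n. mu i * \<bar>f i\<bar> powr p) = 1}"

definition genus_family :: "nat \<Rightarrow> (nat \<Rightarrow> real) \<Rightarrow> real \<Rightarrow> nat \<Rightarrow> (nat \<Rightarrow> real) set set" where
  "genus_family n mu p k = {B. B \<subseteq> sphere_p n mu p \<and> closed B \<and> (\<lambda>f i. - f i) ` B = B \<and> genus B \<ge> k}"

definition p_eigenvalue :: "nat \<Rightarrow> nat set set \<Rightarrow> (nat set \<Rightarrow> real) \<Rightarrow> (nat set \<Rightarrow> real)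
    \<Rightarrow> (nat \<Rightarrow> real) \<Rightarrow> (nat \<Rightarrow> real) \<Rightarrow> real \<Rightarrow> nat \<Rightarrow> real" where
  "p_eigenvalue n E sg w mu kappa p k =
     (INF B \<in> genus_family n mu p k. SUP f \<in> B. rayleigh_p n E sg w mu kappa p f)"

definition cutoff_eigenvalue :: "nat \<Rightarrow> nat set set \<Rightarrow> (nat set \<Rightarrow> real) \<Rightarrow> (nat set \<Rightarrow> real)
    \<Rightarrow> (nat \<Rightarrow> real) \<Rightarrow> (nat \<Rightarrow> real) \<Rightarrow> nat \<Rightarrow> real" where
  "cutoff_eigenvalue n E sg w mu kappa k =
     Lim at_top (\<lambda>p::real. 2 powr (- p) * p_eigenvalue n E sg w mu kappa p k)"

definition subgraphs :: "nat \<Rightarrow> nat set set \<Rightarrow> (nat set \<times> nat set set) set" where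
  "subgraphs n E = {(V0, E0). V0 \<subseteq> {..<n} \<and> E0 \<subseteq> E \<and> (\<forall>e\<in>E0. e \<subseteq> V0)}"

definition norm_adj :: "nat set \<Rightarrow> nat set set \<Rightarrow> (nat set \<Rightarrow> real) \<Rightarrow> (nat set \<Rightarrow> real)
    \<Rightarrow> (nat \<Rightarrow> real) \<Rightarrow> real mat" where
  "norm_adj V0 E0 sg w mu =
     (let vs = sorted_list_of_set V0 in
      mat (card V0) (card V0) (\<lambda>(a, b). let i = vs ! a; j = vs ! b in
          if {i, j} \<in> E0 then sg {i, j} * w {i, j} / mu i else 0))"

definition eig :: "real mat \<Rightarrow> nat \<Rightarrow> real" where
  "eig M k = sorted_list_of_multiset (proots (char_poly M)) ! (k - 1)"

definition antibalanced :: "nat set \<Rightarrow> nat set set \<Rightarrow> (nat set \<Rightarrow> real) \<Rightarrow> bool" where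
  "antibalanced V0 E0 sg \<longleftrightarrow>
     (\<exists>\<tau>::nat \<Rightarrow> real. (\<forall>i\<in>V0. \<tau> i = 1 \<or> \<tau> i = -1) \<and>
        (\<forall>e\<in>E0. \<tau> (Min e) * sg e * \<tau> (Max e) = -1))"

end

theory Submission
  imports Defs "HOL-Homology.Homology" "HOL-Real_Asymp.Real_Asymp"
begin

text \<open>
  Substituting \<open>f\<^sub>i = sgn(h\<^sub>i) |h\<^sub>i|\<close> to the power \<open>2/p\<close> identifies the unit spheres for all \<open>p\<close>
  with the one for \<open>p = 2\<close> by odd homeomorphisms, so the genus families correspond. Under it \<open>2\<close> to the
  power \<open>-p\<close> times the Rayleigh quotient is, edge by edge, a power mean of order \<open>2/p\<close> when
  \<open>-\<sigma> h\<^sub>i h\<^sub>j > 0\<close> and negligible otherwise; it converges uniformly to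
  \<open>\<Sum> w max(0, -\<sigma> h\<^sub>i h\<^sub>j)\<close>. Hence \<open>L\<^sub>k\<close> is the genus min-max of this cut-off form.

  The cut-off form dominates half the quadratic form of the adjacency matrix of \<open>-\<Gamma>\<^sub>0\<close> for every
  spanning subgraph, and it equals it at \<open>h\<close> when \<open>\<Gamma>\<^sub>0\<close> consists of the edges with
  \<open>-\<sigma> h\<^sub>i h\<^sub>j > 0\<close>, a subgraph that the signs of \<open>h\<close> switch to the all-negative one. A symmetric
  set of genus at least \<open>k\<close> meets the orthogonal complement of \<open>k - 1\<close> eigenvectors, which gives the
  lower bound; the whole sphere gives the upper bound for \<open>k = n\<close>. General subgraphs reduce to spanning
  ones by Cauchy interlacing. Borsuk-Ulam is needed for the genus of the sphere: otherwise the
  families, and with them the infima, could be empty.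
\<close>

section \<open>The Borsuk-Ulam theorem\<close>

text \<open>As the order \<open>2/p\<close> of the power mean tends to 0, the mean tends to the
  geometric one; this is the origin of the product \<open>h\<^sub>i h\<^sub>j\<close>. Pointwise
  convergence would not pass through the min-max; an error bound that is uniform on the sphere does,
  and the potential falls into this error because it carries the factor \<open>2 powr (- p)\<close>.
  The minimum and maximum of the definition are \<open>INF\<close> and \<open>SUP\<close> of reals
  and the limit is a \<open>Lim\<close>, all total functions, so nonemptiness, boundedness and
  convergence have to be proved before these values mean anything.

  The subgraph that turns the cut-off form into an adjacency form depends on \<open>h\<close>, and
  no single one serves a whole symmetric set, so for general \<open>k\<close> the argument gives
  only an inequality. For \<open>k = n\<close> the top eigenvalue bounds its form at every
  \<open>h\<close>, and each \<open>h\<close> may choose its own subgraph; the chosen ones are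
  antibalanced, which closes a circle of inequalities and gives both equalities at once. The factor
  1/2 arises because the quadratic form of the matrix counts each edge twice.\<close>

definition usphere :: "nat \<Rightarrow> (nat \<Rightarrow> real) set" where
  "usphere m = {x. (\<Sum>i\<le>m. (x i)\<^sup>2) = 1 \<and> (\<forall>i>m. x i = 0)}"

text \<open>Degrees are defined for self-maps of \<open>nsphere\<close>, which lives in the product
  topology on \<open>nat \<Rightarrow> real\<close>. Its points have \<open>m + 1\<close> free
  coordinates, so \<open>usphere m\<close> has dimension \<open>m\<close>.\<close>

lemma nsphere_eq_usphere: "nsphere m = top_of_set (usphere m)"
  by (simp add: nsphere usphere_def euclidean_product_topology)

text \<open>The box with sides \<open>{- b i..b i}\<close> is compact by Tychonoff. The bound may
  depend on the coordinate, so \<open>b i = 0\<close> can express a support condition.\<close>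

lemma compact_bounded_support:
  fixes K :: "(nat \<Rightarrow> real) set"
  assumes "closed K" and K: "\<And>x i. x \<in> K \<Longrightarrow> \<bar>x i\<bar> \<le> b i"
  shows "compact K"
proof -
  have "compactin (powertop_real UNIV) (PiE UNIV (\<lambda>i. {- b i..b i}))"
    unfolding compactin_PiE by (auto intro!: disjI2)
  then have "compact (PiE UNIV (\<lambda>i. {- b i..b i}))"
    by (simp add: euclidean_product_topology)
  moreover have "K \<subseteq> PiE UNIV (\<lambda>i. {- b i..b i})"
    using K by (force simp: abs_le_iff)
  ultimately show ?thesis
    using assms(1) by (metis compact_Int_closed inf.absorb2 inf_commute)
qed

lemma abs_le_one_usphere:
  assumes "x \<in> usphere m" shows "\<bar>x i\<bar> \<le> 1"
proof (cases "i \<le> m")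
  case True
  then have "(x i)\<^sup>2 \<le> (\<Sum>i\<le>m. (x i)\<^sup>2)"
    by (intro member_le_sum) auto
  then show ?thesis
    using assms by (simp add: usphere_def abs_square_le_1)
qed (use assms in \<open>auto simp: usphere_def\<close>)

lemma closed_usphere: "closed (usphere m)"
proof -
  have "closed {x::nat \<Rightarrow> real. (\<Sum>i\<le>m. (x i)\<^sup>2) = 1}"
    by (intro closed_Collect_eq continuous_intros continuous_on_product_coordinates)
  moreover have "closed {x::nat \<Rightarrow> real. x i = 0}" for i
    by (intro closed_Collect_eq continuous_intros continuous_on_product_coordinates)
  then have "closed (\<Inter>i\<in>{m<..}. {x::nat \<Rightarrow> real. x i = 0})" by blast
  ultimately have "closed ({x::nat \<Rightarrow> real. (\<Sum>i\<le>m. (x i)\<^sup>2) = 1} \<inter> (\<Inter>i\<in>{m<..}. {x. x i = 0}))"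
    by (rule closed_Int)
  also have "\<dots> = usphere m" by (auto simp: usphere_def)
  finally show ?thesis .
qed

lemma compact_usphere: "compact (usphere m)"
  using closed_usphere abs_le_one_usphere by (rule compact_bounded_support)

lemma usphere_uminus: "x \<in> usphere m \<Longrightarrow> (\<lambda>i. - x i) \<in> usphere m"
  by (simp add: usphere_def)

text \<open>If all coordinates were smaller than \<open>1 / (m + 1)\<close>, then so would be their
  squares, and the \<open>m + 1\<close> squares could not add up to 1.\<close>

lemma usphere_large_coordinate:
  assumes "x \<in> usphere m" obtains i where "i \<le> m" "1 / (m + 1) \<le> \<bar>x i\<bar>"
proof -
  have "\<exists>i\<le>m. 1 / (m + 1) \<le> \<bar>x i\<bar>"
  proof (rule ccontr)
    assume "\<not> ?thesis"
    then have *: "\<bar>x i\<bar> < 1 / (m + 1)" if "i \<le> m" for i using that by force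
    have "(x i)\<^sup>2 < 1 / (m + 1)" if "i \<le> m" for i
    proof -
      have "(x i)\<^sup>2 \<le> \<bar>x i\<bar> * 1"
        using abs_le_one_usphere[OF assms, of i] mult_left_mono[of "\<bar>x i\<bar>" 1 "\<bar>x i\<bar>"]
        by (simp add: power2_eq_square flip: abs_mult)
      then show ?thesis using *[OF that] by simp
    qed
    then have "(\<Sum>i\<le>m. (x i)\<^sup>2) < (\<Sum>i\<le>m. 1 / (m + 1))"
      by (intro sum_strict_mono) auto
    then show False using assms by (simp add: usphere_def)
  qed
  then show ?thesis using that by blast
qed

section \<open>Radial projection and degree\<close>

definition normalize_to :: "nat \<Rightarrow> (nat \<Rightarrow> real) \<Rightarrow> nat \<Rightarrow> real" where
  "normalize_to m y = (\<lambda>i. if i \<le> m then y i / sqrt (\<Sum>j\<le>m. (y j)\<^sup>2) else 0)"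

lemma sum_squares_pos:
  fixes y :: "nat \<Rightarrow> real"
  assumes "\<exists>i\<le>m. y i \<noteq> 0" shows "(\<Sum>j\<le>m. (y j)\<^sup>2) > 0"
  using assms by (auto intro: sum_pos2)

lemma normalize_to_in_usphere:
  assumes "\<exists>i\<le>m. y i \<noteq> 0" shows "normalize_to m y \<in> usphere m"
  using sum_squares_pos[OF assms]
  by (auto simp: usphere_def normalize_to_def power_divide sum_nonneg simp flip: sum_divide_distrib)

lemma normalize_to_usphere: "y \<in> usphere m \<Longrightarrow> normalize_to m y = y"
  by (auto simp: usphere_def normalize_to_def fun_eq_iff not_le)

lemma normalize_to_uminus: "normalize_to m (\<lambda>i. - y i) = (\<lambda>i. - normalize_to m y i)"
  by (auto simp: normalize_to_def)

text \<open>Only the coordinates of \<open>F\<close> up to \<open>m\<close> enter, so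
  \<open>F\<close> may be arbitrary above; this admits families such as
  \<open>\<lambda>i. q i x\<close> indexed by all of \<open>nat\<close>.\<close>

lemma continuous_on_normalize_to:
  fixes F :: "'a::topological_space \<Rightarrow> nat \<Rightarrow> real"
  assumes "\<And>i. i \<le> m \<Longrightarrow> continuous_on X (\<lambda>x. F x i)"
    and "\<And>x. x \<in> X \<Longrightarrow> \<exists>i\<le>m. F x i \<noteq> 0"
  shows "continuous_on X (\<lambda>x. normalize_to m (F x))"
proof (rule continuous_on_coordinatewise_then_product)
  fix i
  have "sqrt (\<Sum>j\<le>m. (F x j)\<^sup>2) \<noteq> 0" if "x \<in> X" for x
    using sum_squares_pos[of m "F x"] assms(2)[OF that] by simp
  then show "continuous_on X (\<lambda>x. normalize_to m (F x) i)"
    unfolding normalize_to_def using assms(1) by (cases "i \<le> m") (auto intro!: continuous_intros)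
qed

text \<open>A homotopy need only avoid 0, since radial projection turns it into a homotopy of sphere
  maps. The deformations below are given in this way by formulas in coordinates.\<close>

lemma Brouwer_degree2_normalize_to_homotopy:
  fixes H :: "real \<Rightarrow> (nat \<Rightarrow> real) \<Rightarrow> nat \<Rightarrow> real"
  assumes "\<And>i. i \<le> m \<Longrightarrow> continuous_on ({0..1} \<times> usphere m) (\<lambda>z. H (fst z) (snd z) i)"
    and "\<And>t x. 0 \<le> t \<Longrightarrow> t \<le> 1 \<Longrightarrow> x \<in> usphere m \<Longrightarrow> \<exists>i\<le>m. H t x i \<noteq> 0"
  shows "Brouwer_degree2 m (\<lambda>x. normalize_to m (H 0 x)) = Brouwer_degree2 m (\<lambda>x. normalize_to m (H 1 x))"
proof (rule Brouwer_degree2_homotopic)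
  have "continuous_on ({0..1} \<times> usphere m) (\<lambda>z. normalize_to m (H (fst z) (snd z)))"
    by (rule continuous_on_normalize_to) (use assms in auto)
  then show "homotopic_with (\<lambda>x. True) (nsphere m) (nsphere m)
     (\<lambda>x. normalize_to m (H 0 x)) (\<lambda>x. normalize_to m (H 1 x))"
    unfolding nsphere_eq_usphere homotopic_with_def
    by (intro exI[of _ "\<lambda>z. normalize_to m (H (fst z) (snd z))"])
      (use assms(2) in \<open>auto simp: normalize_to_in_usphere image_subset_iff\<close>)
qed

text \<open>On a patch where coordinate \<open>i\<close> is large and has a fixed sign, it is a
  Lipschitz function of the others: \<open>\<bar>x i - y i\<bar> * \<bar>x i + y i\<bar>\<close> is
  the difference of the squares, which the sphere equation moves to the other coordinates, and the
  second factor is at least \<open>2 / (n + 1)\<close>. The others contribute at most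
  \<open>n * e\<close> to the distance, coordinate \<open>i\<close> at most
  \<open>(n + 1) * (n * e)\<close>.\<close>

lemma usphere_dist_le:
  fixes n :: nat and e :: real
  assumes x: "x \<in> usphere n" and y: "y \<in> usphere n" and i: "i \<le> n"
    and big: "1 / (n + 1) \<le> \<bar>x i\<bar>" "1 / (n + 1) \<le> \<bar>y i\<bar>" and sgn: "x i > 0 \<longleftrightarrow> y i > 0"
    and close: "\<And>j. j \<le> n \<Longrightarrow> j \<noteq> i \<Longrightarrow> \<bar>x j - y j\<bar> \<le> e"
  shows "(\<Sum>j\<le>n. \<bar>x j - y j\<bar>) \<le> n * (n + 2) * e"
proof -
  let ?J = "{..n} - {i}"
  have card: "card ?J = n" using i by simp
  have J: "(\<Sum>j\<le>n. f j) = f i + (\<Sum>j\<in>?J. f j)" for f :: "nat \<Rightarrow> real"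
    using i by (simp add: sum.remove)
  have sJ: "(\<Sum>j\<in>?J. \<bar>x j - y j\<bar>) \<le> n * e"
    using sum_bounded_above[of ?J "\<lambda>j. \<bar>x j - y j\<bar>" e] close card by auto
  have "2 / (n + 1) \<le> \<bar>x i + y i\<bar>"
  proof (cases "x i > 0")
    case True
    then show ?thesis using big sgn by (simp add: field_simps)
  next
    case False
    then show ?thesis using big sgn by (simp add: field_simps)
  qed
  then have "2 / (n + 1) * \<bar>x i - y i\<bar> \<le> \<bar>x i + y i\<bar> * \<bar>x i - y i\<bar>"
    by (intro mult_right_mono) auto
  also have "\<dots> = \<bar>(x i)\<^sup>2 - (y i)\<^sup>2\<bar>"
    by (simp add: power2_eq_square algebra_simps flip: abs_mult)
  also have "(x i)\<^sup>2 - (y i)\<^sup>2 = (\<Sum>j\<in>?J. (y j)\<^sup>2 - (x j)\<^sup>2)"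
    using x y J[of "\<lambda>j. (x j)\<^sup>2"] J[of "\<lambda>j. (y j)\<^sup>2"] by (simp add: usphere_def sum_subtractf)
  also have "\<bar>\<dots>\<bar> \<le> (\<Sum>j\<in>?J. 2 * \<bar>x j - y j\<bar>)"
  proof (rule order_trans[OF sum_abs], rule sum_mono)
    fix j
    have "\<bar>(y j)\<^sup>2 - (x j)\<^sup>2\<bar> = \<bar>x j + y j\<bar> * \<bar>x j - y j\<bar>"
      by (simp add: power2_eq_square algebra_simps abs_minus_commute flip: abs_mult)
    also have "\<dots> \<le> 2 * \<bar>x j - y j\<bar>"
      using abs_le_one_usphere[OF x, of j] abs_le_one_usphere[OF y, of j]
      by (intro mult_right_mono) auto
    finally show "\<bar>(y j)\<^sup>2 - (x j)\<^sup>2\<bar> \<le> 2 * \<bar>x j - y j\<bar>" .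
  qed
  also have "\<dots> \<le> 2 * (n * e)"
    using sJ by (simp flip: sum_distrib_left)
  finally have "\<bar>x i - y i\<bar> \<le> (n + 1) * (n * e)" by (simp add: field_simps)
  then show ?thesis
    using sJ J[of "\<lambda>j. \<bar>x j - y j\<bar>"] by (simp add: algebra_simps)
qed

text \<open>By dimension: the quotients \<open>q i / q (Suc n)\<close> form a Lipschitz image of the \<open>n\<close>-sphere, which would
  have to cover the points of a grid of mesh \<open>1/N\<close> in the unit cube of dimension \<open>n + 1\<close>. There are
  \<open>N ^ (n + 1)\<close> of them, against \<open>O(N ^ n)\<close> cells of the sphere, each too small to hit two of them.\<close>

lemma usphere_avoid_direction:
  fixes q :: "nat \<Rightarrow> (nat \<Rightarrow> real) \<Rightarrow> real" and L c :: real
  assumes lip: "\<And>i x y. i \<le> Suc n \<Longrightarrow> x \<in> usphere n \<Longrightarrow> y \<in> usphere n \<Longrightarrow>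
        \<bar>q i x - q i y\<bar> \<le> L * (\<Sum>j\<le>n. \<bar>x j - y j\<bar>)"
    and c: "c > 0" "\<And>x. x \<in> usphere n \<Longrightarrow> \<exists>i\<le>Suc n. c \<le> \<bar>q i x\<bar>"
    and L: "L \<ge> 0"
  shows "\<exists>a::nat \<Rightarrow> real. \<forall>x\<in>usphere n. \<exists>i\<le>n. q i x \<noteq> a i * q (Suc n) x"
proof (rule ccontr)
  assume "\<not> ?thesis"
  then have "\<forall>a::nat \<Rightarrow> real. \<exists>x\<in>usphere n. \<forall>i\<le>n. q i x = a i * q (Suc n) x" by blast
  then obtain X where X: "\<And>a. X a \<in> usphere n" "\<And>a i. i \<le> n \<Longrightarrow> q i (X a) = a i * q (Suc n) (X a)"
    by metis
  obtain T :: nat where T: "2 * L * (n * (n + 2)) / c < T" using reals_Archimedean2 by blast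
  have T0: "T > 0" using T L c by (smt (verit) divide_nonneg_pos mult_nonneg_nonneg of_nat_0_le_iff gr0I of_nat_0)
  \<comment> \<open>Cells have mesh \<open>1 / (N * T)\<close>, finer than the grid by the factor
    \<open>T\<close>, which absorbs the Lipschitz constant and \<open>c\<close>. There are at most
    \<open>2 * (n + 1) * (3 * T) ^ n * N ^ n\<close> cells, and \<open>N\<close> is taken just
    larger than the factor in front of \<open>N ^ n\<close>.\<close>
  define N where "N = 2 * (n + 1) * (3 * T) ^ n + 1"
  define P where "P = N * T"
  have N0: "N > 0" by (simp add: N_def)
  have P0: "P > 0" using N0 T0 by (simp add: P_def)
  define pt where "pt b = X (\<lambda>i. real (b i) / real N)" for b :: "nat \<Rightarrow> nat"
  define ix where "ix x = (SOME i. i \<le> n \<and> 1 / (n + 1) \<le> \<bar>x i\<bar>)" for x :: "nat \<Rightarrow> real"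
  have ix: "ix x \<le> n \<and> 1 / (n + 1) \<le> \<bar>x (ix x)\<bar>" if "x \<in> usphere n" for x
    unfolding ix_def using usphere_large_coordinate[OF that] by (rule someI_ex) blast
  \<comment> \<open>A cell is given by the index of a large coordinate, its sign, and the floors of
    the other scaled coordinates. The large one is recorded as 0, since
    \<open>usphere_dist_le\<close> controls it by the others; this leaves \<open>n\<close> free
    entries.\<close>
  define key where "key x = (ix x, x (ix x) > 0,
     \<lambda>j\<in>{..n}. if j = ix x then 0 else \<lfloor>P * x j\<rfloor>)" for x :: "nat \<Rightarrow> real"
  define keys where "keys = (SIGMA i:{..n}. (UNIV::bool set) \<times>
     (PiE {..n} (\<lambda>j. if j = i then {0} else {- int P..int P})))"
  have fin: "finite keys"
    unfolding keys_def by (intro finite_SigmaI finite_PiE) auto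
  have card_keys: "card keys = (n + 1) * (2 * (2 * P + 1) ^ n)"
  proof -
    have "card (PiE {..n} (\<lambda>j. if j = i then {0} else {- int P..int P})) = (2 * P + 1) ^ n" if "i \<le> n" for i
    proof -
      have "card (PiE {..n} (\<lambda>j. if j = i then {0} else {- int P..int P})) =
        (\<Prod>j\<le>n. card (if j = i then {0} else {- int P..int P}))"
        by (simp add: card_PiE)
      also have "\<dots> = (\<Prod>j\<in>{..n} - {i}. card {- int P..int P})"
        using that by (subst prod.remove[of _ i]) auto
      also have "\<dots> = (2 * P + 1) ^ n"
      proof -
        have "nat (2 * int P + 1) = Suc (2 * P)" by linarith
        then show ?thesis using that by simp
      qed
      finally show ?thesis .
    qed
    then show ?thesis
      unfolding keys_def by (subst card_SigmaI) (auto simp: finite_PiE card_cartesian_product card_UNIV_bool)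
  qed
  have key_in: "key x \<in> keys" if "x \<in> usphere n" for x
  proof -
    have "\<lfloor>P * x j\<rfloor> \<in> {- int P..int P}" for j
    proof -
      have "real P * \<bar>x j\<bar> \<le> real P * 1" 
        using abs_le_one_usphere[OF that, of j] by (intro mult_left_mono) auto
      then have "\<bar>real P * x j\<bar> \<le> real P" by (simp add: abs_mult)
      then show ?thesis by (auto simp: le_floor_iff floor_le_iff)
    qed
    then show ?thesis using ix[OF that] by (auto simp: key_def keys_def)
  qed
  have inj: "inj_on (\<lambda>b. key (pt b)) (PiE {..n} (\<lambda>_. {..<N}))"
  proof (rule inj_onI, rule ccontr)
    fix b b' assume b: "b \<in> PiE {..n} (\<lambda>_. {..<N})" and b': "b' \<in> PiE {..n} (\<lambda>_. {..<N})"
      and eq: "key (pt b) = key (pt b')" and ne: "b \<noteq> b'"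
    obtain i where i: "i \<le> n" "b i \<noteq> b' i"
      using PiE_ext[OF b b'] ne by auto
    let ?x = "pt b" and ?y = "pt b'"
    have xy: "?x \<in> usphere n" "?y \<in> usphere n" using X(1) by (auto simp: pt_def)
    have keys: "ix ?x = ix ?y \<and> (?x (ix ?x) > 0) = (?y (ix ?y) > 0) \<and>
        (\<lambda>j\<in>{..n}. if j = ix ?x then 0 else \<lfloor>P * ?x j\<rfloor>) = (\<lambda>j\<in>{..n}. if j = ix ?y then 0 else \<lfloor>P * ?y j\<rfloor>)"
      using eq[unfolded key_def prod.inject] .
    note ixe = conjunct1[OF keys]
    have sg: "?x (ix ?x) > 0 \<longleftrightarrow> ?y (ix ?x) > 0"
      using conjunct1[OF conjunct2[OF keys]] by (simp only: ixe)
    have fl: "\<lfloor>P * ?x j\<rfloor> = \<lfloor>P * ?y j\<rfloor>" if "j \<le> n" "j \<noteq> ix ?x" for j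
    proof -
      have "(\<lambda>j\<in>{..n}. if j = ix ?x then 0 else \<lfloor>P * ?x j\<rfloor>) j = (\<lambda>j\<in>{..n}. if j = ix ?y then 0 else \<lfloor>P * ?y j\<rfloor>) j"
        using conjunct2[OF conjunct2[OF keys]] by (rule fun_cong)
      then show ?thesis using that ixe by simp
    qed
    have cl: "\<bar>?x j - ?y j\<bar> \<le> 1 / P" if "j \<le> n" "j \<noteq> ix ?x" for j
    proof -
      have "\<bar>real P * ?x j - real P * ?y j\<bar> \<le> 1"
        using fl[OF that] by linarith
      then have "real P * \<bar>?x j - ?y j\<bar> \<le> 1"
        by (metis abs_mult abs_of_nat right_diff_distrib)
      then show ?thesis using P0 by (simp add: field_simps)
    qed
    let ?d = "\<Sum>j\<le>n. \<bar>?x j - ?y j\<bar>"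
    have d: "?d \<le> n * (n + 2) * (1 / P)"
      using usphere_dist_le[OF xy, of "ix ?x" "1 / P"] ix[OF xy(1)] ix[OF xy(2)] sg cl
      unfolding ixe by blast
    let ?a = "\<lambda>i. real (b i) / real N" and ?a' = "\<lambda>i. real (b' i) / real N"
    have a1: "\<bar>?a i\<bar> \<le> 1" if "i \<le> n" for i
      using PiE_mem[OF b, of i] that N0 by simp
    have a1': "\<bar>?a' i\<bar> \<le> 1" if "i \<le> n" for i
      using PiE_mem[OF b', of i] that N0 by simp
    have qx: "q i ?x = ?a i * q (Suc n) ?x" and qy: "q i ?y = ?a' i * q (Suc n) ?y"
      using X(2)[OF i(1)] by (simp_all add: pt_def)
    \<comment> \<open>The entries of the grid point have size at most 1, so the last coordinate of
      \<open>q\<close> dominates all others in size and inherits the lower bound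
      \<open>c\<close>.\<close>
    have big: "c \<le> \<bar>q (Suc n) ?y\<bar>"
    proof -
      obtain l where l: "l \<le> Suc n" "c \<le> \<bar>q l ?y\<bar>" using c(2)[OF xy(2)] by blast
      show ?thesis
      proof (cases "l = Suc n")
        case False
        then have "l \<le> n" using l by simp
        then have "q l ?y = ?a' l * q (Suc n) ?y" using X(2) by (simp add: pt_def)
        then have "\<bar>q l ?y\<bar> \<le> 1 * \<bar>q (Suc n) ?y\<bar>"
          unfolding abs_mult using a1'[OF \<open>l \<le> n\<close>] by (metis abs_mult mult_right_mono abs_ge_zero)
        then show ?thesis using l by simp
      qed (use l in simp)
    qed
    \<comment> \<open>Distinct grid points differ by at least \<open>1 / N\<close> in coordinate
      \<open>i\<close>, while two points of one cell are \<open>O(1 / P)\<close> apart with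
      \<open>P = N * T\<close>; the choice of \<open>T\<close> makes these incompatible.\<close>
    have "1 \<le> \<bar>real (b i) - real (b' i)\<bar>" using i(2) by linarith
    then have "1 / N * c \<le> \<bar>?a i - ?a' i\<bar> * \<bar>q (Suc n) ?y\<bar>"
      using big c N0 by (intro mult_mono) (auto simp: field_simps simp flip: diff_divide_distrib)
    also have "\<dots> = \<bar>?a i * (q (Suc n) ?y - q (Suc n) ?x) + (q i ?x - q i ?y)\<bar>"
      unfolding qx qy abs_mult[symmetric] by (simp add: algebra_simps)
    also have "\<dots> \<le> \<bar>?a i\<bar> * \<bar>q (Suc n) ?y - q (Suc n) ?x\<bar> + \<bar>q i ?x - q i ?y\<bar>"
      by (metis abs_mult abs_triangle_ineq)
    also have "\<dots> \<le> 1 * \<bar>q (Suc n) ?y - q (Suc n) ?x\<bar> + \<bar>q i ?x - q i ?y\<bar>"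
      using a1[OF i(1)] by (intro add_right_mono mult_right_mono) auto
    also have "\<dots> \<le> L * ?d + L * ?d"
      using lip[of "Suc n" ?x ?y] lip[of i ?x ?y] xy i by (simp add: abs_minus_commute)
    also have "\<dots> \<le> 2 * (L * (n * (n + 2) * (1 / P)))"
      using mult_left_mono[OF d L] by simp
    finally have "c * T \<le> 2 * L * (n * (n + 2))"
      using N0 T0 by (simp add: P_def field_simps)
    then show False using T c by (simp add: field_simps)
  qed
  have "N ^ (n + 1) = card (PiE {..n} (\<lambda>_. {..<N}))" by (simp add: card_PiE)
  also have "\<dots> \<le> card keys"
    using inj by (rule card_inj_on_le) (use key_in X(1) fin in \<open>auto simp: pt_def\<close>)
  also have "\<dots> \<le> (n + 1) * (2 * (3 * T * N) ^ n)"
    unfolding card_keys using P0 by (intro mult_left_mono power_mono) (auto simp: P_def)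
  also have "\<dots> = 2 * (n + 1) * (3 * T) ^ n * N ^ n" by (simp add: power_mult_distrib algebra_simps)
  also have "\<dots> < N * N ^ n" using N0 by (intro mult_strict_right_mono) (auto simp: N_def)
  finally show False by simp
qed

section \<open>Odd Lipschitz approximation on the sphere\<close>

definition l1_lipschitz_on :: "nat \<Rightarrow> (nat \<Rightarrow> real) set \<Rightarrow> ((nat \<Rightarrow> real) \<Rightarrow> real) \<Rightarrow> bool" where
  "l1_lipschitz_on m X f \<longleftrightarrow>
     (\<exists>L. \<forall>x\<in>X. \<forall>y\<in>X. \<bar>f x - f y\<bar> \<le> L * (\<Sum>j\<le>m. \<bar>x j - y j\<bar>))"

lemma l1_lipschitz_on_nonneg:
  assumes "l1_lipschitz_on m X f"
  shows "\<exists>L\<ge>0. \<forall>x\<in>X. \<forall>y\<in>X. \<bar>f x - f y\<bar> \<le> L * (\<Sum>j\<le>m. \<bar>x j - y j\<bar>)"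
proof -
  from assms obtain L where
    L: "\<And>x y. x \<in> X \<Longrightarrow> y \<in> X \<Longrightarrow> \<bar>f x - f y\<bar> \<le> L * (\<Sum>j\<le>m. \<bar>x j - y j\<bar>)"
    unfolding l1_lipschitz_on_def by blast
  have "\<bar>f x - f y\<bar> \<le> max 0 L * (\<Sum>j\<le>m. \<bar>x j - y j\<bar>)" if "x \<in> X" "y \<in> X" for x y
    by (rule order_trans[OF L[OF that]]) (intro mult_right_mono sum_nonneg, auto)
  then show ?thesis by (intro exI[of _ "max 0 L"]) simp
qed

text \<open>The hypotheses of Stone-Weierstrass: products of Lipschitz functions are Lipschitz
  because continuous factors are bounded on the compact sphere, and the coordinates separate
  points.\<close>

lemma function_ring_on_lipschitz:
  "function_ring_on {f. continuous_on (usphere m) f \<and> l1_lipschitz_on m (usphere m) f} (usphere m)"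
proof
  show "compact (usphere m)" by (rule compact_usphere)
next
  fix f g
  assume f: "f \<in> {f. continuous_on (usphere m) f \<and> l1_lipschitz_on m (usphere m) f}"
     and g: "g \<in> {f. continuous_on (usphere m) f \<and> l1_lipschitz_on m (usphere m) f}"
  from f have "l1_lipschitz_on m (usphere m) f" by simp
  then obtain L where L0: "L \<ge> 0"
    and L: "\<And>x y. x \<in> usphere m \<Longrightarrow> y \<in> usphere m \<Longrightarrow> \<bar>f x - f y\<bar> \<le> L * (\<Sum>j\<le>m. \<bar>x j - y j\<bar>)"
    using l1_lipschitz_on_nonneg by blast
  from g have "l1_lipschitz_on m (usphere m) g" by simp
  then obtain L' where L0': "L' \<ge> 0"
    and L': "\<And>x y. x \<in> usphere m \<Longrightarrow> y \<in> usphere m \<Longrightarrow> \<bar>g x - g y\<bar> \<le> L' * (\<Sum>j\<le>m. \<bar>x j - y j\<bar>)"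
    using l1_lipschitz_on_nonneg by blast
  have "l1_lipschitz_on m (usphere m) (\<lambda>x. f x + g x)"
    unfolding l1_lipschitz_on_def
  proof (intro exI ballI)
    fix x y assume "x \<in> usphere m" "y \<in> usphere m"
    from L[OF this] L'[OF this]
    show "\<bar>f x + g x - (f y + g y)\<bar> \<le> (L + L') * (\<Sum>j\<le>m. \<bar>x j - y j\<bar>)"
      by (simp add: distrib_right)
  qed
  then show "(\<lambda>x. f x + g x) \<in> {f. continuous_on (usphere m) f \<and> l1_lipschitz_on m (usphere m) f}"
    using f g by (auto intro: continuous_intros)
  have "\<exists>C. \<forall>x\<in>usphere m. \<bar>h x\<bar> \<le> C" if "continuous_on (usphere m) h" for h :: "(nat \<Rightarrow> real) \<Rightarrow> real"
  proof -
    have "bounded (h ` usphere m)"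
      using that compact_continuous_image compact_usphere compact_imp_bounded by blast
    then show ?thesis by (auto simp: bounded_iff)
  qed
  then obtain C C' where C: "\<And>x. x \<in> usphere m \<Longrightarrow> \<bar>f x\<bar> \<le> C" and C': "\<And>x. x \<in> usphere m \<Longrightarrow> \<bar>g x\<bar> \<le> C'"
    using f g by blast
  have "l1_lipschitz_on m (usphere m) (\<lambda>x. f x * g x)"
    unfolding l1_lipschitz_on_def
  proof (intro exI ballI)
    fix x y assume xy: "x \<in> usphere m" "y \<in> usphere m"
    let ?d = "\<Sum>j\<le>m. \<bar>x j - y j\<bar>"
    have "f x * g x - f y * g y = f x * (g x - g y) + g y * (f x - f y)"
      by (simp add: algebra_simps)
    then have "\<bar>f x * g x - f y * g y\<bar> \<le> \<bar>f x\<bar> * \<bar>g x - g y\<bar> + \<bar>g y\<bar> * \<bar>f x - f y\<bar>"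
      by (metis abs_mult abs_triangle_ineq)
    also have "\<dots> \<le> C * (L' * ?d) + C' * (L * ?d)"
      using C[OF xy(1)] C'[OF xy(2)] L[OF xy] L'[OF xy]
      by (intro add_mono mult_mono) (use abs_ge_zero order_trans in blast)+
    finally show "\<bar>f x * g x - f y * g y\<bar> \<le> (C * L' + C' * L) * ?d"
      by (simp add: algebra_simps)
  qed
  then show "(\<lambda>x. f x * g x) \<in> {f. continuous_on (usphere m) f \<and> l1_lipschitz_on m (usphere m) f}"
    using f g by (auto intro: continuous_intros)
next
  show "(\<lambda>_. c) \<in> {f. continuous_on (usphere m) f \<and> l1_lipschitz_on m (usphere m) f}" for c
    by (auto simp: l1_lipschitz_on_def intro!: exI[of _ 0])
next
  fix x y assume xy: "x \<in> usphere m" "y \<in> usphere m" "x \<noteq> y"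
  then obtain i where "x i \<noteq> y i" by blast
  then have i: "i \<le> m" using xy by (fastforce simp: usphere_def)
  have "\<bar>u i - v i\<bar> \<le> 1 * (\<Sum>j\<le>m. \<bar>u j - v j\<bar>)" for u v :: "nat \<Rightarrow> real"
    using member_le_sum[of i "{..m}" "\<lambda>j. \<bar>u j - v j\<bar>"] i by simp
  then have "l1_lipschitz_on m (usphere m) (\<lambda>x. x i)"
    unfolding l1_lipschitz_on_def by blast
  then show "\<exists>f\<in>{f. continuous_on (usphere m) f \<and> l1_lipschitz_on m (usphere m) f}. f x \<noteq> f y"
    using \<open>x i \<noteq> y i\<close> by (intro bexI[of _ "\<lambda>x. x i"])
      (auto intro: continuous_on_subset[OF continuous_on_product_coordinates])
qed auto

text \<open>Passing to the odd part of an approximation does not increase the error, as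
  \<open>f\<close> is its own odd part, and keeps the Lipschitz condition, as the antipodal map is
  an isometry.\<close>

lemma odd_lipschitz_approximation:
  assumes cont: "continuous_on (usphere m) f" and odd: "\<And>x. x \<in> usphere m \<Longrightarrow> f (\<lambda>i. - x i) = - f x"
    and e: "e > 0"
  obtains q where "continuous_on (usphere m) q" "l1_lipschitz_on m (usphere m) q"
    "\<And>x. q (\<lambda>i. - x i) = - q x" "\<And>x. x \<in> usphere m \<Longrightarrow> \<bar>f x - q x\<bar> < e"
proof -
  interpret function_ring_on "{f. continuous_on (usphere m) f \<and> l1_lipschitz_on m (usphere m) f}" "usphere m"
    by (rule function_ring_on_lipschitz)
  obtain g where g: "continuous_on (usphere m) g" "l1_lipschitz_on m (usphere m) g"
    and ge: "\<And>x. x \<in> usphere m \<Longrightarrow> \<bar>f x - g x\<bar> < e"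
    using Stone_Weierstrass_basic[OF cont e] by blast
  define q where "q x = (g x - g (\<lambda>i. - x i)) / 2" for x
  obtain L where L: "\<And>x y. x \<in> usphere m \<Longrightarrow> y \<in> usphere m \<Longrightarrow> \<bar>g x - g y\<bar> \<le> L * (\<Sum>j\<le>m. \<bar>x j - y j\<bar>)"
    using g(2) unfolding l1_lipschitz_on_def by blast
  show thesis
  proof (rule that)
    have "continuous_on (usphere m) (\<lambda>x. g (\<lambda>i. - x i))"
    proof (rule continuous_on_compose2[OF g(1)])
      show "continuous_on (usphere m) (\<lambda>x i. - x i)"
        by (intro continuous_on_coordinatewise_then_product continuous_intros
            continuous_on_subset[OF continuous_on_product_coordinates]) auto
    qed (auto intro: usphere_uminus)
    then show "continuous_on (usphere m) q"
      unfolding q_def using g(1) by (intro continuous_intros) auto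
    have "\<bar>q x - q y\<bar> \<le> L * (\<Sum>j\<le>m. \<bar>x j - y j\<bar>)" if "x \<in> usphere m" "y \<in> usphere m" for x y
    proof -
      have "\<bar>g (\<lambda>i. - x i) - g (\<lambda>i. - y i)\<bar> \<le> L * (\<Sum>j\<le>m. \<bar>x j - y j\<bar>)"
        using L[OF usphere_uminus[OF that(1)] usphere_uminus[OF that(2)]] by (simp add: abs_minus_commute)
      moreover have eq: "q x - q y = ((g x - g y) - (g (\<lambda>i. - x i) - g (\<lambda>i. - y i))) / 2"
        by (simp add: q_def field_simps)
      have "2 * \<bar>q x - q y\<bar> \<le> \<bar>g x - g y\<bar> + \<bar>g (\<lambda>i. - x i) - g (\<lambda>i. - y i)\<bar>"
        using abs_triangle_ineq4[of "g x - g y" "g (\<lambda>i. - x i) - g (\<lambda>i. - y i)"] unfolding eq by simp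
      ultimately show ?thesis using L[OF that] by (smt (verit))
    qed
    then show "l1_lipschitz_on m (usphere m) q" unfolding l1_lipschitz_on_def by blast
    show "q (\<lambda>i. - x i) = - q x" for x by (simp add: q_def field_simps)
    show "\<bar>f x - q x\<bar> < e" if x: "x \<in> usphere m" for x
      using ge[OF x] ge[OF usphere_uminus[OF x]] unfolding odd[OF x] q_def abs_less_iff
      by (simp add: field_simps)
  qed
qed

section \<open>Odd maps have odd degree\<close>

lemma usphere_Suc_iff: "x \<in> usphere m \<longleftrightarrow> x \<in> usphere (Suc m) \<and> x (Suc m) = 0"
  unfolding usphere_def by (auto simp: Suc_lessI) (metis Suc_lessI)

text \<open>The induction step needs a homotopy to an odd map that preserves the equator. After a Lipschitz
  approximation \<open>q\<close>, a linear shear moves a direction that \<open>q\<close> omits on the equator to the pole; the last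
  coordinate can then be multiplied by \<open>\<bar>x (Suc n)\<bar>\<close> without creating a zero.\<close>

lemma odd_map_odd_Brouwer_degree2:
  assumes "continuous_on (usphere m) f" "f ` usphere m \<subseteq> usphere m"
    and "\<And>x. x \<in> usphere m \<Longrightarrow> f (\<lambda>i. - x i) = (\<lambda>i. - f x i)"
  shows "odd (Brouwer_degree2 m f)"
  using assms
proof (induction m arbitrary: f)
  case 0
  have us0: "x \<in> usphere 0 \<longleftrightarrow> x = (\<lambda>i. if i = 0 then 1 else 0) \<or> x = (\<lambda>i. if i = 0 then - 1 else 0)" for x
    by (auto simp: usphere_def fun_eq_iff power2_eq_1_iff)
  have cm: "continuous_map (nsphere 0) (nsphere 0) f"
    using 0 by (simp add: nsphere_eq_usphere image_subset_iff_funcset)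
  \<comment> \<open>In dimension 0 an odd map is the identity or the antipodal map, so the square of
    its degree is 1.\<close>
  have "f (f x) = x" if "x \<in> usphere 0" for x
  proof -
    define e :: "nat \<Rightarrow> real" where "e = (\<lambda>i. if i = 0 then 1 else 0)"
    have us: "x \<in> usphere 0 \<longleftrightarrow> x = e \<or> x = (\<lambda>i. - e i)" for x
      unfolding us0 e_def by (auto simp: fun_eq_iff)
    have "f e = e \<or> f e = (\<lambda>i. - e i)" using 0(2) us by blast
    moreover have "f (\<lambda>i. - e i) = (\<lambda>i. - f e i)" using 0(3) us by blast
    ultimately show ?thesis using that unfolding us by auto
  qed
  then have "Brouwer_degree2 0 (f \<circ> f) = Brouwer_degree2 0 id"
    by (intro Brouwer_degree2_eq) (simp add: nsphere_eq_usphere)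
  then show ?case
    unfolding Brouwer_degree2_compose[OF cm cm] Brouwer_degree2_id
    by (metis even_mult_iff odd_one)
next
  case (Suc n)
  let ?S = "usphere (Suc n)" and ?m = "Suc n"
  have comp: "continuous_on ?S (\<lambda>x. f x i)" for i
    using Suc.prems(1) by (rule continuous_on_product_then_coordinatewise)
  \<comment> \<open>Some coordinate of each unit vector has size at least \<open>2 * e\<close>, and
    an \<open>e\<close>-approximation keeps that coordinate at least \<open>e\<close> in size. So
    the segment from \<open>f x\<close> to \<open>q x\<close> misses 0, and \<open>e\<close> is the
    lower bound required by \<open>usphere_avoid_direction\<close>.\<close>
  define e :: real where "e = 1 / (2 * (?m + 1))"
  have e: "e > 0" by (simp add: e_def)
  have "\<exists>q. continuous_on ?S q \<and> l1_lipschitz_on ?m ?S q \<and> (\<forall>x. q (\<lambda>i. - x i) = - q x) \<and>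
     (\<forall>x\<in>?S. \<bar>f x i - q x\<bar> < e)" for i
  proof -
    have fodd: "f (\<lambda>j. - x j) i = - f x i" if "x \<in> ?S" for x
      by (simp add: Suc.prems(3)[OF that])
    show ?thesis
      by (rule odd_lipschitz_approximation[OF comp[of i] fodd e]) blast+
  qed
  then obtain q where q: "\<And>i. continuous_on ?S (q i)" "\<And>i. l1_lipschitz_on ?m ?S (q i)"
     "\<And>i x. q i (\<lambda>i. - x i) = - q i x" "\<And>i x. x \<in> ?S \<Longrightarrow> \<bar>f x i - q i x\<bar> < e" by metis
  have big: "\<exists>i\<le>?m. 2 * e \<le> \<bar>f x i\<bar>" if "x \<in> ?S" for x
  proof -
    have "f x \<in> ?S" using Suc.prems(2) that by blast
    then obtain i where "i \<le> ?m" "1 / (?m + 1) \<le> \<bar>f x i\<bar>" by (rule usphere_large_coordinate)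
    moreover have "2 * e = 1 / (?m + 1)" by (simp add: e_def field_simps)
    ultimately show ?thesis by metis
  qed
  have bigq: "\<exists>i\<le>?m. e \<le> \<bar>q i x\<bar>" if "x \<in> ?S" for x
    using big[OF that] q(4)[OF that] by (smt (verit))
  have prodcont: "continuous_on ({0..1::real} \<times> ?S) (\<lambda>z. g (snd z))" if "continuous_on ?S g" for g :: "(nat \<Rightarrow> real) \<Rightarrow> real"
    by (rule continuous_on_compose2[OF that]) (auto intro: continuous_intros)
  have "Brouwer_degree2 ?m f = Brouwer_degree2 ?m (\<lambda>x. normalize_to ?m (f x))"
    by (rule Brouwer_degree2_eq)
      (use Suc.prems(2) normalize_to_usphere in \<open>force simp: nsphere_eq_usphere\<close>)
  also have "\<dots> = Brouwer_degree2 ?m (\<lambda>x. normalize_to ?m (\<lambda>i. q i x))"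
  proof -
    have nzI: "h \<noteq> 0" if "\<bar>h - y\<bar> < \<bar>y\<bar>" for h y :: real
      using that by auto
    let ?H = "\<lambda>t x i. (1 - t) * f x i + t * q i x"
    have "continuous_on ({0..1} \<times> ?S) (\<lambda>z. ?H (fst z) (snd z) i)" for i
      by (intro continuous_intros prodcont comp q)
    moreover have "\<exists>i\<le>?m. ?H t x i \<noteq> 0" if "0 \<le> t" "t \<le> 1" "x \<in> ?S" for t x
    proof -
      obtain i where i: "i \<le> ?m" "2 * e \<le> \<bar>f x i\<bar>" using big \<open>x \<in> ?S\<close> by blast
      have "?H t x i - f x i = t * (q i x - f x i)" by (simp add: algebra_simps)
      then have "\<bar>?H t x i - f x i\<bar> \<le> 1 * \<bar>q i x - f x i\<bar>"
        using that by (simp only: abs_mult) (intro mult_right_mono, auto)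
      moreover have "\<bar>q i x - f x i\<bar> < \<bar>f x i\<bar>"
        using q(4)[OF \<open>x \<in> ?S\<close>, of i] i e by linarith
      ultimately have "\<bar>?H t x i - f x i\<bar> < \<bar>f x i\<bar>" unfolding mult_1 by (rule order.strict_trans1)
      then have "?H t x i \<noteq> 0" by (rule nzI)
      then show ?thesis using i by blast
    qed
    ultimately have "Brouwer_degree2 ?m (\<lambda>x. normalize_to ?m (?H 0 x)) = Brouwer_degree2 ?m (\<lambda>x. normalize_to ?m (?H 1 x))"
      by (rule Brouwer_degree2_normalize_to_homotopy)
    then show ?thesis by simp
  qed
  finally have deg1: "Brouwer_degree2 ?m f = Brouwer_degree2 ?m (\<lambda>x. normalize_to ?m (\<lambda>i. q i x))" .
  obtain a :: "nat \<Rightarrow> real" where a: "\<And>x. x \<in> usphere n \<Longrightarrow> \<exists>i\<le>n. q i x \<noteq> a i * q ?m x"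
  proof -
    obtain L where L: "\<And>i. L i \<ge> 0" "\<And>i x y. x \<in> ?S \<Longrightarrow> y \<in> ?S \<Longrightarrow> \<bar>q i x - q i y\<bar> \<le> L i * (\<Sum>j\<le>?m. \<bar>x j - y j\<bar>)"
    proof -
      have "\<exists>L\<ge>0. \<forall>x\<in>?S. \<forall>y\<in>?S. \<bar>q i x - q i y\<bar> \<le> L * (\<Sum>j\<le>?m. \<bar>x j - y j\<bar>)" for i
        using q(2)[of i] by (rule l1_lipschitz_on_nonneg)
      then obtain L where "\<forall>i. L i \<ge> 0 \<and> (\<forall>x\<in>?S. \<forall>y\<in>?S. \<bar>q i x - q i y\<bar> \<le> L i * (\<Sum>j\<le>?m. \<bar>x j - y j\<bar>))"
        by metis
      then show ?thesis using that by blast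
    qed
    have "\<exists>a::nat \<Rightarrow> real. \<forall>x\<in>usphere n. \<exists>i\<le>n. q i x \<noteq> a i * q (Suc n) x"
    proof (rule usphere_avoid_direction[where L = "\<Sum>i\<le>?m. L i" and c = e])
      fix i x y assume "i \<le> Suc n" and xy: "x \<in> usphere n" "y \<in> usphere n"
      then have "\<bar>q i x - q i y\<bar> \<le> L i * (\<Sum>j\<le>n. \<bar>x j - y j\<bar>)"
        using L(2)[of x y i] by (simp add: usphere_Suc_iff[of _ n])
      also have "\<dots> \<le> (\<Sum>i\<le>?m. L i) * (\<Sum>j\<le>n. \<bar>x j - y j\<bar>)"
        using \<open>i \<le> Suc n\<close> L(1) by (intro mult_right_mono member_le_sum sum_nonneg) auto
      finally show "\<bar>q i x - q i y\<bar> \<le> (\<Sum>i\<le>?m. L i) * (\<Sum>j\<le>n. \<bar>x j - y j\<bar>)" .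
    next
      show "0 \<le> (\<Sum>i\<le>?m. L i)" using L(1) by (rule sum_nonneg)
    next
      fix x assume "x \<in> usphere n"
      then show "\<exists>i\<le>Suc n. e \<le> \<bar>q i x\<bar>" using bigq usphere_Suc_iff by blast
    qed (fact e)
    then show ?thesis using that by blast
  qed
  \<comment> \<open>On the equator the factor \<open>\<bar>x ?m\<bar>\<close> kills the last
    coordinate, and the choice of \<open>a\<close> keeps some other coordinate nonzero. The factor
    is even, so \<open>F\<close> remains odd.\<close>
  define F where "F x i = (if i = ?m then \<bar>x ?m\<bar> * q ?m x else q i x - a i * q ?m x)" for x i
  have F_nz: "\<exists>i\<le>?m. F x i \<noteq> 0" if x: "x \<in> ?S" for x
  proof (cases "x ?m = 0")
    case True
    then have "x \<in> usphere n" using that usphere_Suc_iff by blast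
    then obtain i where "i \<le> n" "q i x \<noteq> a i * q ?m x" using a by blast
    then show ?thesis by (intro exI[of _ i]) (auto simp: F_def)
  next
    case False
    obtain i where "i \<le> ?m" "q i x \<noteq> 0" using bigq[OF x] e by force
    \<comment> \<open>Where \<open>q ?m\<close> vanishes, the shear changes nothing and another
      coordinate of \<open>q\<close> survives; elsewhere the last coordinate is nonzero.\<close>
    with False have "F x (if q ?m x = 0 then i else ?m) \<noteq> 0" by (auto simp: F_def)
    then show ?thesis using \<open>i \<le> ?m\<close> by (intro exI[of _ "if q ?m x = 0 then i else ?m"]) auto
  qed
  have deg2: "Brouwer_degree2 ?m (\<lambda>x. normalize_to ?m (\<lambda>i. q i x)) = Brouwer_degree2 ?m (\<lambda>x. normalize_to ?m (F x))"
  proof -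
    \<comment> \<open>Shear and damping of the last coordinate at once. For \<open>t < 1\<close> the
      damping factor is positive and the linear map applied to \<open>q\<close> is invertible, so
      nonvanishing is inherited; \<open>t = 1\<close> is \<open>F_nz\<close>.\<close>
    define H where "H t x i = (if i = ?m then (1 - t + t * \<bar>x ?m\<bar>) * q ?m x else q i x - t * a i * q ?m x)"
      for t x i
    have H0: "H 0 x = (\<lambda>i. q i x)" and H1: "H 1 x = F x" for x
      by (simp_all add: H_def F_def fun_eq_iff)
    have "continuous_on ({0..1} \<times> ?S) (\<lambda>z. H (fst z) (snd z) i)" for i
    proof -
      have cx: "continuous_on ({0..1::real} \<times> ?S) (\<lambda>z. snd z ?m)"
        by (rule prodcont) (rule continuous_on_subset[OF continuous_on_product_coordinates], simp)
      have cq: "continuous_on ({0..1::real} \<times> ?S) (\<lambda>z. q i (snd z))" for i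
        using q(1) by (rule prodcont)
      have c1: "continuous_on ({0..1::real} \<times> ?S) (\<lambda>z. (1 - fst z + fst z * \<bar>snd z ?m\<bar>) * q ?m (snd z))"
        by (intro continuous_intros cx cq)
      have c2: "continuous_on ({0..1::real} \<times> ?S) (\<lambda>z. q i (snd z) - fst z * a i * q ?m (snd z))"
        by (intro continuous_intros cq)
      show ?thesis
      proof (cases "i = ?m")
        case True
        show ?thesis unfolding H_def if_P[OF True] by (rule c1)
      next
        case False
        show ?thesis unfolding H_def if_not_P[OF False] by (rule c2)
      qed
    qed
    moreover have "\<exists>i\<le>?m. H t x i \<noteq> 0" if t: "0 \<le> t" "t \<le> 1" and x: "x \<in> ?S" for t x
    proof (cases "t = 1")
      case True
      show ?thesis unfolding True H1 by (rule F_nz[OF x])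
    next
      case False
      then have "1 - t + t * \<bar>x ?m\<bar> > 0" using t by (simp add: add_pos_nonneg)
      moreover obtain i where "i \<le> ?m" "q i x \<noteq> 0" using bigq[OF x] e by force
      ultimately have "i \<le> ?m" "H t x (if q ?m x = 0 then i else ?m) \<noteq> 0" by (auto simp: H_def)
      then show ?thesis by (intro exI[of _ "if q ?m x = 0 then i else ?m"]) auto
    qed
    ultimately have "Brouwer_degree2 ?m (\<lambda>x. normalize_to ?m (H 0 x)) = Brouwer_degree2 ?m (\<lambda>x. normalize_to ?m (H 1 x))"
      by (rule Brouwer_degree2_normalize_to_homotopy)
    then show ?thesis by (simp only: H0 H1)
  qed
  have deg: "Brouwer_degree2 ?m f = Brouwer_degree2 ?m (\<lambda>x. normalize_to ?m (F x))"
    unfolding deg1 by (rule deg2)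
  define g where "g x = normalize_to ?m (F x)" for x
  have g_cont: "continuous_on ?S g"
    unfolding g_def
  proof (rule continuous_on_normalize_to)
    show "continuous_on ?S (\<lambda>x. F x i)" for i
    proof -
      have cx: "continuous_on ?S (\<lambda>x. x ?m)"
        by (rule continuous_on_subset[OF continuous_on_product_coordinates]) simp
      have "continuous_on ?S (\<lambda>x. \<bar>x ?m\<bar> * q ?m x)" "continuous_on ?S (\<lambda>x. q i x - a i * q ?m x)"
        by (intro continuous_intros cx q)+
      then show ?thesis unfolding F_def by (cases "i = ?m") simp_all
    qed
  qed (rule F_nz)
  have g_in: "g x \<in> ?S" if "x \<in> ?S" for x
    unfolding g_def using F_nz[OF that] by (rule normalize_to_in_usphere)
  have g_odd: "g (\<lambda>i. - x i) = (\<lambda>i. - g x i)" for x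
  proof -
    have "F (\<lambda>i. - x i) = (\<lambda>i. - F x i)" by (auto simp: F_def q(3))
    then show ?thesis by (simp add: g_def normalize_to_uminus)
  qed
  have g_eq: "g x \<in> usphere n" if "x \<in> usphere n" for x
  proof -
    have "x \<in> ?S" "x ?m = 0" using that usphere_Suc_iff by blast+
    then have "g x ?m = 0" by (simp add: g_def normalize_to_def F_def)
    then show ?thesis using g_in[OF \<open>x \<in> ?S\<close>] usphere_Suc_iff by blast
  qed
  have sub: "usphere n \<subseteq> ?S" using usphere_Suc_iff by blast
  have "odd (Brouwer_degree2 n g)"
    by (rule Suc.IH) (use g_cont sub g_eq g_odd in \<open>auto intro: continuous_on_subset\<close>)
  \<comment> \<open>An odd map that preserves the equator has degrees of the same parity on the
    sphere and on the equator. As \<open>usphere n\<close> is literally a subset of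
    \<open>usphere ?m\<close>, one function \<open>g\<close> serves for both.\<close>
  moreover have "even (Brouwer_degree2 ?m g - Brouwer_degree2 (?m - Suc 0) g)"
    by (rule Borsuk_odd_mapping_degree_step)
      (use g_cont g_in g_odd g_eq in \<open>auto simp: nsphere_eq_usphere fun_eq_iff\<close>)
  ultimately show ?case unfolding deg by (simp add: g_def[abs_def])
qed

text \<open>Without a zero, the normalized map sends the whole sphere into its equator
  \<open>usphere n\<close>. So it preserves the equator, where its degree is odd; yet as a self-map
  of \<open>usphere m\<close> it is not surjective and has degree 0, although the two degrees must
  have the same parity.\<close>

theorem Borsuk_Ulam:
  assumes cont: "continuous_on (usphere m) h"
    and odd: "\<And>x. x \<in> usphere m \<Longrightarrow> h (\<lambda>i. - x i) = (\<lambda>i. - h x i)"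
  shows "\<exists>x\<in>usphere m. \<forall>i<m. h x i = (0::real)"
proof (cases m)
  case 0
  have "(\<lambda>i. if i = 0 then 1 else 0) \<in> usphere 0" by (simp add: usphere_def)
  then show ?thesis using 0 by blast
next
  case (Suc n)
  show ?thesis
  proof (rule ccontr)
    assume "\<not> ?thesis"
    then have nz: "\<exists>i\<le>n. h x i \<noteq> 0" if "x \<in> usphere m" for x
      using that Suc less_Suc_eq_le by blast
    define g where "g x = normalize_to n (h x)" for x
    have cg: "continuous_on (usphere m) g"
      unfolding g_def
      by (rule continuous_on_normalize_to) (use nz cont in \<open>auto intro: continuous_on_product_then_coordinatewise\<close>)
    have g_in: "g x \<in> usphere n" if "x \<in> usphere m" for x
      unfolding g_def using nz[OF that] by (rule normalize_to_in_usphere)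
    have sub: "usphere n \<subseteq> usphere m" using usphere_Suc_iff Suc by blast
    have g_odd: "g (\<lambda>i. - x i) = (\<lambda>i. - g x i)" if "x \<in> usphere m" for x
      unfolding g_def odd[OF that] by (rule normalize_to_uminus)
    have "odd (Brouwer_degree2 n g)"
      by (rule odd_map_odd_Brouwer_degree2) (use cg sub g_in g_odd in \<open>auto intro: continuous_on_subset\<close>)
    moreover have cm: "continuous_map (nsphere m) (nsphere m) g"
      using cg g_in sub by (auto simp: nsphere_eq_usphere)
    have "even (Brouwer_degree2 m g - Brouwer_degree2 (m - Suc 0) g)"
      by (rule Borsuk_odd_mapping_degree_step[OF cm])
        (use g_in g_odd sub Suc in \<open>auto simp: nsphere_eq_usphere fun_eq_iff\<close>)
    moreover have "Brouwer_degree2 m g = 0"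
    proof -
      have "(\<lambda>i. if i = m then 1 else 0) \<in> usphere m" 
        by (auto simp: usphere_def if_distrib[of "\<lambda>x. x\<^sup>2"] cong: if_cong)
      moreover have "(\<lambda>i. if i = m then 1 else 0) \<notin> usphere n" 
        using Suc by (auto simp: usphere_def)
      ultimately have "g ` topspace (nsphere m) \<noteq> topspace (nsphere m)"
        using g_in by (auto simp: nsphere_eq_usphere set_eq_iff image_iff) metis
      then obtain b where "homotopic_with (\<lambda>x. True) (nsphere m) (nsphere m) g (\<lambda>x. b)"
        using nullhomotopic_nonsurjective_sphere_map[OF cm] by blast
      then show ?thesis by (rule Brouwer_degree2_nullhomotopic)
    qed
    ultimately show False using Suc by simp
  qed
qed

section \<open>Eigenvalues of weighted symmetric matrices\<close>

text \<open>Gaussian elimination by one equation at a time. The index types are arbitrary so that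
  conditions of different kinds can form one system, as in
  \<open>subgraph_interlacing\<close>.\<close>

lemma homogeneous_system_nontrivial:
  fixes a :: "'r \<Rightarrow> 's \<Rightarrow> 'a::field"
  assumes "finite R" "finite S" "card R < card S"
  shows "\<exists>f. (\<exists>s\<in>S. f s \<noteq> 0) \<and> (\<forall>s. s \<notin> S \<longrightarrow> f s = 0) \<and> (\<forall>r\<in>R. (\<Sum>s\<in>S. a r s * f s) = 0)"
  using assms
proof (induction R arbitrary: S a rule: finite_induct)
  case empty
  then obtain s where "s \<in> S" by fastforce
  then show ?case by (intro exI[of _ "\<lambda>s. if s \<in> S then 1 else 0"]) auto
next
  case (insert r R)
  show ?case
  proof (cases "\<forall>s\<in>S. a r s = 0")
    case True
    have "card R < card S" using insert by simp
    then obtain f where "\<exists>s\<in>S. f s \<noteq> 0" "\<forall>s. s \<notin> S \<longrightarrow> f s = 0" "\<forall>r\<in>R. (\<Sum>s\<in>S. a r s * f s) = 0"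
      using insert.IH[of S a] insert.prems by blast
    then show ?thesis using True by (intro exI[of _ f]) auto
  next
    case False
    then obtain p where p: "p \<in> S" "a r p \<noteq> 0" by blast
    let ?S = "S - {p}"
    \<comment> \<open>The system after the unknown \<open>p\<close> has been eliminated with the
      help of equation \<open>r\<close>; below, \<open>g\<close> restores the value at
      \<open>p\<close> that \<open>r\<close> dictates.\<close>
    define b where "b q s = a q s - a q p * a r s / a r p" for q s
    have "card R < card ?S" using insert p by simp
    then obtain f where f: "\<exists>s\<in>?S. f s \<noteq> 0" "\<forall>s. s \<notin> ?S \<longrightarrow> f s = 0" "\<forall>q\<in>R. (\<Sum>s\<in>?S. b q s * f s) = 0"
      using insert.IH[of ?S b] insert.prems by blast
    define g where "g = f(p := - (\<Sum>s\<in>?S. a r s * f s) / a r p)"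
    have gS: "(\<Sum>s\<in>S. a q s * g s) = a q p * g p + (\<Sum>s\<in>?S. a q s * f s)" for q
      using insert.prems(1) p by (subst sum.remove[of _ p]) (auto simp: g_def intro!: sum.cong)
    have "(\<Sum>s\<in>S. a r s * g s) = 0" unfolding gS using p by (simp add: g_def)
    moreover have "(\<Sum>s\<in>S. a q s * g s) = 0" if "q \<in> R" for q
    proof -
      have "(\<Sum>s\<in>?S. a q s * f s) = (\<Sum>s\<in>?S. b q s * f s) + a q p / a r p * (\<Sum>s\<in>?S. a r s * f s)"
        unfolding sum_distrib_left sum.distrib[symmetric] b_def
        by (intro sum.cong) (auto simp: algebra_simps)
      then show ?thesis unfolding gS using that f(3) by (simp add: g_def)
    qed
    moreover have "\<exists>s\<in>S. g s \<noteq> 0" using f(1) by (auto simp: g_def)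
    moreover have "\<forall>s. s \<notin> S \<longrightarrow> g s = 0" using f(2) p by (auto simp: g_def)
    ultimately show ?thesis by blast
  qed
qed

section \<open>Weighted inner products and the spectral theorem\<close>

definition wip :: "nat \<Rightarrow> (nat \<Rightarrow> real) \<Rightarrow> (nat \<Rightarrow> real) \<Rightarrow> (nat \<Rightarrow> real) \<Rightarrow> real" where
  "wip m mu f g = (\<Sum>i<m. mu i * f i * g i)"

text \<open>The normalized matrix need not be symmetric but is self-adjoint for \<open>wip\<close>,
  and \<open>qform\<close> with the unnormalized symmetric \<open>a\<close> is its bilinear form
  there. Hence the eigenvalue equations below carry \<open>mu i\<close> on the right.\<close>

definition qform :: "nat \<Rightarrow> (nat \<Rightarrow> nat \<Rightarrow> real) \<Rightarrow> (nat \<Rightarrow> real) \<Rightarrow> (nat \<Rightarrow> real) \<Rightarrow> real" where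
  "qform m a f g = (\<Sum>i<m. f i * (\<Sum>j<m. a i j * g j))"

lemma wip_commute: "wip m mu f g = wip m mu g f"
  by (simp add: wip_def mult_ac)

lemma wip_cong: "(\<And>i. i < m \<Longrightarrow> f i = f' i) \<Longrightarrow> (\<And>i. i < m \<Longrightarrow> g i = g' i) \<Longrightarrow> wip m mu f g = wip m mu f' g'"
  by (simp add: wip_def)

lemma qform_cong: "(\<And>i. i < m \<Longrightarrow> f i = f' i) \<Longrightarrow> (\<And>i. i < m \<Longrightarrow> g i = g' i) \<Longrightarrow> qform m a f g = qform m a f' g'"
  by (simp add: qform_def)

lemma wip_add_left: "wip m mu (\<lambda>i. f i + t * g i) h = wip m mu f h + t * wip m mu g h"
  by (simp add: wip_def algebra_simps sum.distrib sum_distrib_left)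

lemma wip_add_right: "wip m mu h (\<lambda>i. f i + t * g i) = wip m mu h f + t * wip m mu h g"
  by (simp add: wip_def algebra_simps sum.distrib sum_distrib_left)

lemma qform_add_left: "qform m a (\<lambda>i. f i + t * g i) h = qform m a f h + t * qform m a g h"
  by (simp add: qform_def algebra_simps sum.distrib sum_distrib_left)

lemma qform_add_right: "qform m a h (\<lambda>i. f i + t * g i) = qform m a h f + t * qform m a h g"
  by (simp add: qform_def algebra_simps sum.distrib sum_distrib_left)

lemma qform_commute:
  assumes "\<And>i j. i < m \<Longrightarrow> j < m \<Longrightarrow> a i j = a j i"
  shows "qform m a f g = qform m a g f"
proof -
  have "qform m a f g = (\<Sum>j<m. \<Sum>i<m. f i * (a i j * g j))"
    unfolding qform_def sum_distrib_left by (rule sum.swap)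
  also have "\<dots> = qform m a g f"
    unfolding qform_def sum_distrib_left using assms by (intro sum.cong) auto
  finally show ?thesis .
qed

lemma wip_scale: "wip m mu (\<lambda>i. c * f i) (\<lambda>i. c * f i) = c\<^sup>2 * wip m mu f f"
  by (simp add: wip_def sum_distrib_left power2_eq_square mult_ac)

lemma qform_scale: "qform m a (\<lambda>i. c * f i) (\<lambda>i. c * f i) = c\<^sup>2 * qform m a f f"
  by (simp add: qform_def sum_distrib_left power2_eq_square mult_ac)

lemma wip_scale_right: "wip m mu f (\<lambda>i. c * g i) = c * wip m mu f g"
  by (simp add: wip_def sum_distrib_left mult_ac)

lemma wip_self_nonneg: "(\<And>i. i < m \<Longrightarrow> mu i > 0) \<Longrightarrow> wip m mu f f \<ge> 0"
  unfolding wip_def by (intro sum_nonneg) (simp add: mult.assoc less_imp_le)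

lemma wip_self_eq_0:
  assumes "\<And>i. i < m \<Longrightarrow> mu i > 0" "wip m mu f f = 0" "i < m" shows "f i = 0"
proof -
  have "\<forall>i\<in>{..<m}. mu i * f i * f i = 0"
    using assms(2) unfolding wip_def
    by (subst (asm) sum_nonneg_eq_0_iff) (auto simp: mult.assoc less_imp_le assms(1))
  then have "mu i * f i * f i = 0" using assms(3) by blast
  then show ?thesis using assms(1)[OF assms(3)] by simp
qed

lemma quadratic_nonneg_imp_linear_0:
  fixes b c :: real
  assumes "\<And>t. 0 \<le> 2 * t * b + t\<^sup>2 * c" shows "b = 0"
proof (rule ccontr)
  assume "b \<noteq> 0"
  \<comment> \<open>The minimizer of the quadratic with \<open>c\<close> replaced by the positive
    number \<open>\<bar>c\<bar> + 1\<close>.\<close>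
  define t where "t = - b / (\<bar>c\<bar> + 1)"
  have "2 * t * b + t\<^sup>2 * c \<le> 2 * t * b + t\<^sup>2 * (\<bar>c\<bar> + 1)"
    by (intro add_left_mono mult_left_mono) auto
  also have "\<dots> = - (b\<^sup>2 / (\<bar>c\<bar> + 1))"
    by (simp add: t_def power2_eq_square divide_simps add_nonneg_eq_0_iff)
  also have "\<dots> < 0" using \<open>b \<noteq> 0\<close> by (simp add: add_nonneg_pos)
  finally show False using assms[of t] by simp
qed

text \<open>Minimize the Rayleigh quotient over the orthogonal complement of the eigenvectors found so far.\<close>

lemma next_eigenvector:
  fixes m :: nat and mu :: "nat \<Rightarrow> real"
  assumes sym: "\<And>i j. i < m \<Longrightarrow> j < m \<Longrightarrow> a i j = a j i" and mu: "\<And>i. i < m \<Longrightarrow> mu i > 0"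
    and r: "r < m"
    and eig: "\<And>s i. s < r \<Longrightarrow> i < m \<Longrightarrow> (\<Sum>j<m. a i j * v s j) = lam s * mu i * v s i"
  shows "\<exists>f l. wip m mu f f = 1 \<and> (\<forall>s<r. wip m mu (v s) f = 0) \<and>
     (\<forall>i<m. (\<Sum>j<m. a i j * f j) = l * mu i * f i) \<and>
     (\<forall>g. (\<forall>s<r. wip m mu (v s) g = 0) \<longrightarrow> l * wip m mu g g \<le> qform m a g g)"
proof -
  define K where "K = {f. (\<forall>i\<ge>m. f i = 0) \<and> wip m mu f f = 1 \<and> (\<forall>s<r. wip m mu (v s) f = 0)}"
  have scale: "(\<lambda>i. if i < m then g i / sqrt (wip m mu g g) else 0) \<in> K"
    if "\<forall>s<r. wip m mu (v s) g = 0" "wip m mu g g > 0" for g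
  proof -
    let ?c = "1 / sqrt (wip m mu g g)"
    have "wip m mu (\<lambda>i. if i < m then g i / sqrt (wip m mu g g) else 0) (\<lambda>i. if i < m then g i / sqrt (wip m mu g g) else 0)
      = wip m mu (\<lambda>i. ?c * g i) (\<lambda>i. ?c * g i)" by (rule wip_cong) auto
    also have "\<dots> = 1" unfolding wip_scale using that(2) by (simp add: power_divide)
    finally have 1: "wip m mu (\<lambda>i. if i < m then g i / sqrt (wip m mu g g) else 0) (\<lambda>i. if i < m then g i / sqrt (wip m mu g g) else 0) = 1" .
    have "wip m mu (v s) (\<lambda>i. if i < m then g i / sqrt (wip m mu g g) else 0) = wip m mu (v s) (\<lambda>i. ?c * g i)" for s
      by (rule wip_cong) auto
    then have "wip m mu (v s) (\<lambda>i. if i < m then g i / sqrt (wip m mu g g) else 0) = 0" if "s < r" for s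
      using \<open>\<forall>s<r. _\<close> that by (simp only: wip_scale_right)
    then show ?thesis using 1 by (simp add: K_def)
  qed
  have "K \<noteq> {}"
  proof -
    obtain f where f: "\<exists>s\<in>{..<m}. f s \<noteq> 0" "\<forall>q\<in>{..<r}. (\<Sum>s\<in>{..<m}. mu s * v q s * f s) = 0"
      using homogeneous_system_nontrivial[of "{..<r}" "{..<m}" "\<lambda>q s. mu s * v q s"] r by auto
    have "wip m mu f f \<noteq> 0" using f(1) wip_self_eq_0[of m mu f] mu by blast
    then have "wip m mu f f > 0" using wip_self_nonneg[of m mu f] mu by force
    then show ?thesis using scale[of f] f(2) by (auto simp: wip_def)
  qed
  have cc: "continuous_on K (\<lambda>f. f i)" for i
    by (rule continuous_on_subset[OF continuous_on_product_coordinates]) simp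
  have cw: "continuous_on X (\<lambda>f. wip m mu (g f) (h f))"
    if "\<And>i. continuous_on X (\<lambda>f. g f i)" "\<And>i. continuous_on X (\<lambda>f. h f i)"
    for X :: "(nat \<Rightarrow> real) set" and g h :: "(nat \<Rightarrow> real) \<Rightarrow> nat \<Rightarrow> real"
    unfolding wip_def by (intro continuous_intros that)
  have "compact K"
  proof (rule compact_bounded_support[of _ "\<lambda>i. if i < m then sqrt (1 / mu i) else 0"])
    have c: "continuous_on UNIV (\<lambda>f::nat \<Rightarrow> real. f i)" for i by (rule continuous_on_product_coordinates)
    have "closed {f::nat \<Rightarrow> real. f i = 0}" for i by (intro closed_Collect_eq continuous_intros c)
    then have 1: "closed (\<Inter>i\<in>{m..}. {f::nat \<Rightarrow> real. f i = 0})" by blast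
    have 2: "closed {f. wip m mu f f = 1}" by (intro closed_Collect_eq continuous_intros cw c)
    have "closed {f. wip m mu (v s) f = 0}" for s by (intro closed_Collect_eq continuous_intros cw c)
    then have 3: "closed (\<Inter>s\<in>{..<r}. {f. wip m mu (v s) f = 0})" by blast
    have "K = (\<Inter>i\<in>{m..}. {f. f i = 0}) \<inter> ({f. wip m mu f f = 1} \<inter> (\<Inter>s\<in>{..<r}. {f. wip m mu (v s) f = 0}))"
      by (auto simp: K_def)
    then show "closed K" using 1 2 3 by (simp only: closed_Int)
  next
    fix f i assume f: "f \<in> K"
    show "\<bar>f i\<bar> \<le> (if i < m then sqrt (1 / mu i) else 0)"
    proof (cases "i < m")
      case True
      have "mu i * f i * f i \<le> wip m mu f f"
        unfolding wip_def using True mu by (intro member_le_sum) (auto simp: mult.assoc less_imp_le)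
      then have "mu i * (f i)\<^sup>2 \<le> 1" using f by (simp add: K_def power2_eq_square mult.assoc)
      then have "(f i)\<^sup>2 \<le> 1 / mu i" using mu[OF True] by (simp add: field_simps)
      then show ?thesis using True real_le_rsqrt[of "\<bar>f i\<bar>" "1 / mu i"] by simp
    qed (use f in \<open>auto simp: K_def\<close>)
  qed
  moreover have "continuous_on K (\<lambda>f. qform m a f f)"
    unfolding qform_def by (intro continuous_intros cc)
  ultimately obtain f where f: "f \<in> K" and min: "\<And>g. g \<in> K \<Longrightarrow> qform m a f f \<le> qform m a g g"
    using continuous_attains_inf[of K "\<lambda>f. qform m a f f"] \<open>K \<noteq> {}\<close> by blast
  define l where "l = qform m a f f"
  have ff: "wip m mu f f = 1" and vf: "\<And>s. s < r \<Longrightarrow> wip m mu (v s) f = 0" using f by (auto simp: K_def)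
  have lower: "l * wip m mu g g \<le> qform m a g g" if g: "\<forall>s<r. wip m mu (v s) g = 0" for g
  proof (cases "wip m mu g g = 0")
    case True
    then have "g i = 0" if "i < m" for i using wip_self_eq_0[of m mu g i] mu that by blast
    then have "qform m a g g = 0" by (simp add: qform_def)
    then show ?thesis using True by simp
  next
    case False
    then have pos: "wip m mu g g > 0" using wip_self_nonneg[of m mu g] mu by force
    let ?c = "1 / sqrt (wip m mu g g)"
    let ?h = "\<lambda>i. if i < m then g i / sqrt (wip m mu g g) else 0"
    have "l \<le> qform m a ?h ?h" unfolding l_def using scale[OF g pos] by (rule min)
    also have "\<dots> = qform m a (\<lambda>i. ?c * g i) (\<lambda>i. ?c * g i)" by (rule qform_cong) auto
    also have "\<dots> = qform m a g g / wip m mu g g"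
      unfolding qform_scale using pos by (simp add: power_divide)
    finally show ?thesis using pos by (simp add: field_simps)
  qed
  have comm: "qform m a g h = qform m a h g" for g h
    using sym by (rule qform_commute)
  \<comment> \<open>The residual of the eigenvalue equation for \<open>f\<close>, divided by
    \<open>mu\<close>. It is orthogonal to the earlier eigenvectors, hence an admissible direction
    of variation, and up to a factor 2 the first variation along it is its own squared norm, which
    must therefore vanish.\<close>
  define g where "g i = (\<Sum>j<m. a i j * f j) / mu i - l * f i" for i
  have g_eq: "mu i * g i = (\<Sum>j<m. a i j * f j) - l * mu i * f i" if "i < m" for i
    using mu[OF that] by (simp add: g_def field_simps)
  have wg: "wip m mu h g = qform m a h f - l * wip m mu h f" for h
  proof -
    have "wip m mu h g = (\<Sum>i<m. h i * (mu i * g i))" by (simp add: wip_def mult_ac)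
    also have "\<dots> = (\<Sum>i<m. h i * ((\<Sum>j<m. a i j * f j) - l * mu i * f i))"
      by (intro sum.cong) (auto simp: g_eq)
    also have "\<dots> = qform m a h f - l * wip m mu h f"
      by (simp add: qform_def wip_def right_diff_distrib sum_subtractf sum_distrib_left mult_ac)
    finally show ?thesis .
  qed
  have vg: "wip m mu (v s) g = 0" if "s < r" for s
  proof -
    have "qform m a (v s) f = qform m a f (v s)" by (rule comm)
    also have "\<dots> = (\<Sum>i<m. f i * (lam s * mu i * v s i))"
      unfolding qform_def using eig[OF that] by (intro sum.cong) auto
    also have "\<dots> = lam s * wip m mu (v s) f" by (simp add: wip_def sum_distrib_left mult_ac)
    finally show ?thesis using vf[OF that] by (simp add: wg)
  qed
  have "qform m a f g - l * wip m mu f g = 0"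
  proof (rule quadratic_nonneg_imp_linear_0)
    fix t
    have "\<forall>s<r. wip m mu (v s) (\<lambda>i. f i + t * g i) = 0" by (simp add: wip_add_right vf vg)
    from lower[OF this] have "0 \<le> qform m a (\<lambda>i. f i + t * g i) (\<lambda>i. f i + t * g i) -
        l * wip m mu (\<lambda>i. f i + t * g i) (\<lambda>i. f i + t * g i)" by simp
    also have "\<dots> = 2 * t * (qform m a f g - l * wip m mu f g) + t\<^sup>2 * (qform m a g g - l * wip m mu g g)"
      unfolding wip_add_left wip_add_right qform_add_left qform_add_right ff l_def[symmetric]
        wip_commute[of m mu g f] comm[of g f]
      by (simp add: algebra_simps power2_eq_square)
    finally show "0 \<le> 2 * t * (qform m a f g - l * wip m mu f g) + t\<^sup>2 * (qform m a g g - l * wip m mu g g)" .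
  qed
  then have "wip m mu g g = 0"
    using wg[of g] by (simp add: comm[of g f] wip_commute[of m mu g f])
  then have "g i = 0" if "i < m" for i using wip_self_eq_0[of m mu g i] mu that by blast
  then have "(\<Sum>j<m. a i j * f j) = l * mu i * f i" if "i < m" for i
    using g_eq[OF that] that by simp
  then show ?thesis using ff vf lower by blast
qed

text \<open>The variational inequality is carried through the induction because it yields both the
  order of the eigenvalues and the lower half of the min-max principle.\<close>

lemma orthonormal_eigenvectors:
  fixes m :: nat and mu :: "nat \<Rightarrow> real"
  assumes sym: "\<And>i j. i < m \<Longrightarrow> j < m \<Longrightarrow> a i j = a j i" and mu: "\<And>i. i < m \<Longrightarrow> mu i > 0"
  shows "r \<le> m \<Longrightarrow> \<exists>v lam. (\<forall>s<r. \<forall>t<r. wip m mu (v s) (v t) = (if s = t then 1 else 0)) \<and>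
     (\<forall>s<r. \<forall>i<m. (\<Sum>j<m. a i j * v s j) = lam s * mu i * v s i) \<and>
     (\<forall>s<r. \<forall>g. (\<forall>t<s. wip m mu (v t) g = 0) \<longrightarrow> lam s * wip m mu g g \<le> qform m a g g)"
proof (induction r)
  case (Suc r)
  then obtain v lam where v: "\<forall>s<r. \<forall>t<r. wip m mu (v s) (v t) = (if s = t then 1 else 0)"
     "\<forall>s<r. \<forall>i<m. (\<Sum>j<m. a i j * v s j) = lam s * mu i * v s i"
     "\<forall>s<r. \<forall>g. (\<forall>t<s. wip m mu (v t) g = 0) \<longrightarrow> lam s * wip m mu g g \<le> qform m a g g"
    by auto
  have "r < m" using Suc by simp
  obtain f l where f: "wip m mu f f = 1" "\<forall>s<r. wip m mu (v s) f = 0"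
     "\<forall>i<m. (\<Sum>j<m. a i j * f j) = l * mu i * f i"
     "\<forall>g. (\<forall>s<r. wip m mu (v s) g = 0) \<longrightarrow> l * wip m mu g g \<le> qform m a g g"
    using next_eigenvector[of m a mu r v lam] sym mu \<open>r < m\<close> v(2) by blast
  have "\<forall>s<r. wip m mu f (v s) = 0" using f(2) by (simp add: wip_commute)
  then have "\<forall>s<Suc r. \<forall>t<Suc r. wip m mu ((v(r := f)) s) ((v(r := f)) t) = (if s = t then 1 else 0)"
    using v(1) f(1,2) by (auto simp: less_Suc_eq)
  moreover have "\<forall>s<Suc r. \<forall>i<m. (\<Sum>j<m. a i j * (v(r := f)) s j) = (lam(r := l)) s * mu i * (v(r := f)) s i"
    using v(2) f(3) by (auto simp: less_Suc_eq)
  moreover have "\<forall>s<Suc r. \<forall>g. (\<forall>t<s. wip m mu ((v(r := f)) t) g = 0) \<longrightarrow> (lam(r := l)) s * wip m mu g g \<le> qform m a g g"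
  proof (intro allI impI)
    fix s g assume s: "s < Suc r" and g: "\<forall>t<s. wip m mu ((v(r := f)) t) g = 0"
    then have "\<forall>t<s. wip m mu (v t) g = 0" by (metis fun_upd_other less_Suc_eq nat_neq_iff order.strict_trans)
    then show "(lam(r := l)) s * wip m mu g g \<le> qform m a g g"
      using v(3) f(4) s by (cases "s = r") auto
  qed
  ultimately show ?case by blast
qed simp

text \<open>Orthonormality says that \<open>Q * P\<close> is the identity. For square matrices so is
  \<open>P * Q\<close>, and its entries express completeness.\<close>

lemma orthonormal_completeness:
  assumes on: "\<And>s t. s < m \<Longrightarrow> t < m \<Longrightarrow> wip m mu (v s) (v t) = (if s = t then 1 else 0)"
    and i: "i < m"
  shows "g i = (\<Sum>t<m. wip m mu (v t) g * v t i)"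
proof -
  define P where "P = mat m m (\<lambda>(i, s). v s i)"
  define Q where "Q = mat m m (\<lambda>(s, i). mu i * v s i)"
  have P: "P \<in> carrier_mat m m" and Q: "Q \<in> carrier_mat m m" by (auto simp: P_def Q_def)
  have "Q * P = 1\<^sub>m m"
    by (rule eq_matI) (use on in \<open>auto simp: P_def Q_def scalar_prod_def wip_def atLeast0LessThan\<close>)
  then have "P * Q = 1\<^sub>m m" using mat_mult_left_right_inverse[OF Q P] by blast
  then have PQ: "(\<Sum>t<m. v t i * (mu j * v t j)) = (if i = j then 1 else 0)" if "j < m" for j
  proof -
    have "(\<Sum>t<m. v t i * (mu j * v t j)) = (P * Q) $$ (i, j)"
      using that i by (simp add: P_def Q_def scalar_prod_def atLeast0LessThan)
    then show ?thesis unfolding \<open>P * Q = 1\<^sub>m m\<close> using that i by simp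
  qed
  have "(\<Sum>t<m. wip m mu (v t) g * v t i) = (\<Sum>t<m. \<Sum>j<m. v t i * (mu j * v t j) * g j)"
    by (simp add: wip_def sum_distrib_left sum_distrib_right mult_ac)
  also have "\<dots> = (\<Sum>j<m. \<Sum>t<m. v t i * (mu j * v t j) * g j)" by (rule sum.swap)
  also have "\<dots> = (\<Sum>j<m. (if i = j then 1 else 0) * g j)"
    by (intro sum.cong) (simp_all add: PQ flip: sum_distrib_right)
  also have "\<dots> = g i" using i by (simp add: if_distrib[of "\<lambda>x. x * _"] cong: if_cong)
  finally show ?thesis by simp
qed

text \<open>Both forms are diagonal in an orthonormal eigenbasis, with values
  \<open>\<Sum>s\<in>T. lam s * (c s)\<^sup>2\<close> and
  \<open>\<Sum>s\<in>T. (c s)\<^sup>2\<close>.\<close>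

lemma qform_eigenvector_span_le:
  assumes on: "\<And>s t. s < m \<Longrightarrow> t < m \<Longrightarrow> wip m mu (v s) (v t) = (if s = t then 1 else 0)"
    and eig: "\<And>s i. s < m \<Longrightarrow> i < m \<Longrightarrow> (\<Sum>j<m. a i j * v s j) = lam s * mu i * v s i"
    and T: "T \<subseteq> {..<m}" "\<And>t. t \<in> T \<Longrightarrow> lam t \<le> l"
    and g: "\<And>i. i < m \<Longrightarrow> g i = (\<Sum>t\<in>T. c t * v t i)"
  shows "qform m a g g \<le> l * wip m mu g g"
proof -
  have fin: "finite T" using T(1) finite_subset by blast
  have coeff: "wip m mu (v t) g = c t" if "t \<in> T" for t
  proof -
    have "wip m mu (v t) g = (\<Sum>i<m. \<Sum>s\<in>T. c s * (mu i * v t i * v s i))"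
      using g by (simp add: wip_def sum_distrib_left mult_ac)
    also have "\<dots> = (\<Sum>s\<in>T. \<Sum>i<m. c s * (mu i * v t i * v s i))" by (rule sum.swap)
    also have "\<dots> = (\<Sum>s\<in>T. c s * wip m mu (v t) (v s))" by (simp add: wip_def sum_distrib_left)
    also have "\<dots> = (\<Sum>s\<in>T. c s * (if t = s then 1 else 0))"
      by (intro sum.cong refl, subst on) (use T(1) that in auto)
    also have "\<dots> = (\<Sum>s\<in>T. if t = s then c s else 0)" by (intro sum.cong) auto
    also have "\<dots> = c t" using that fin by simp
    finally show ?thesis .
  qed
  have "wip m mu g g = (\<Sum>i<m. \<Sum>s\<in>T. c s * (mu i * v s i * g i))"
    unfolding wip_def using g by (intro sum.cong) (simp_all add: sum_distrib_left sum_distrib_right mult_ac)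
  also have "\<dots> = (\<Sum>s\<in>T. \<Sum>i<m. c s * (mu i * v s i * g i))" by (rule sum.swap)
  also have "\<dots> = (\<Sum>s\<in>T. (c s)\<^sup>2)"
    using coeff by (intro sum.cong) (simp_all add: wip_def power2_eq_square flip: sum_distrib_left)
  finally have norm: "wip m mu g g = (\<Sum>s\<in>T. (c s)\<^sup>2)" .
  have "(\<Sum>j<m. a i j * g j) = (\<Sum>s\<in>T. c s * lam s * mu i * v s i)" if "i < m" for i
  proof -
    have "(\<Sum>j<m. a i j * g j) = (\<Sum>j<m. \<Sum>s\<in>T. c s * (a i j * v s j))"
      using g by (intro sum.cong) (simp_all add: sum_distrib_left mult_ac)
    also have "\<dots> = (\<Sum>s\<in>T. \<Sum>j<m. c s * (a i j * v s j))" by (rule sum.swap)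
    also have "\<dots> = (\<Sum>s\<in>T. c s * (lam s * mu i * v s i))"
      using eig T(1) that by (intro sum.cong) (auto simp flip: sum_distrib_left)
    finally show ?thesis by (simp add: mult_ac)
  qed
  then have "qform m a g g = (\<Sum>i<m. \<Sum>s\<in>T. c s * lam s * (mu i * v s i * g i))"
    unfolding qform_def by (intro sum.cong) (simp_all add: sum_distrib_left mult_ac)
  also have "\<dots> = (\<Sum>s\<in>T. \<Sum>i<m. c s * lam s * (mu i * v s i * g i))" by (rule sum.swap)
  also have "\<dots> = (\<Sum>s\<in>T. lam s * (c s)\<^sup>2)"
  proof (rule sum.cong[OF refl])
    fix s assume s: "s \<in> T"
    have "(\<Sum>i<m. c s * lam s * (mu i * v s i * g i)) = c s * lam s * wip m mu (v s) g"
      by (simp only: wip_def sum_distrib_left)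
    then show "(\<Sum>i<m. c s * lam s * (mu i * v s i * g i)) = lam s * (c s)\<^sup>2"
      by (simp add: coeff[OF s] power2_eq_square)
  qed
  also have "\<dots> \<le> (\<Sum>s\<in>T. l * (c s)\<^sup>2)"
    using T(2) by (intro sum_mono mult_right_mono) auto
  finally show ?thesis by (simp add: norm sum_distrib_left)
qed

text \<open>Diagonalization turns the characteristic polynomial, whose roots define
  \<open>eig\<close>, into the product of the factors \<open>[:- lam s, 1:]\<close>, so the sorted
  roots are the \<open>lam s\<close> with multiplicity. \<open>lam\<close> is indexed from 0,
  \<open>eig\<close> from 1.\<close>

lemma eig_mat_eigenvectors:
  assumes mu: "\<And>i. i < m \<Longrightarrow> mu i > 0"
    and on: "\<And>s t. s < m \<Longrightarrow> t < m \<Longrightarrow> wip m mu (v s) (v t) = (if s = t then 1 else 0)"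
    and eig: "\<And>s i. s < m \<Longrightarrow> i < m \<Longrightarrow> (\<Sum>j<m. a i j * v s j) = lam s * mu i * v s i"
    and mono: "\<And>s t. s \<le> t \<Longrightarrow> t < m \<Longrightarrow> lam s \<le> lam t"
    and k: "1 \<le> k" "k \<le> m"
  shows "eig (mat m m (\<lambda>(i, j). a i j / mu i)) k = lam (k - 1)"
proof -
  let ?M = "mat m m (\<lambda>(i, j). a i j / mu i)"
  define P where "P = mat m m (\<lambda>(i, s). v s i)"
  define Q where "Q = mat m m (\<lambda>(s, i). mu i * v s i)"
  define D where "D = mat m m (\<lambda>(s, t). if s = t then lam s else 0)"
  have P: "P \<in> carrier_mat m m" and Q: "Q \<in> carrier_mat m m" and D: "D \<in> carrier_mat m m"
    and M: "?M \<in> carrier_mat m m" by (auto simp: P_def Q_def D_def)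
  have QP: "Q * P = 1\<^sub>m m"
    by (rule eq_matI) (use on in \<open>auto simp: P_def Q_def scalar_prod_def wip_def atLeast0LessThan\<close>)
  then have PQ: "P * Q = 1\<^sub>m m" using mat_mult_left_right_inverse[OF Q P] by blast
  have MP: "?M * P = P * D"
  proof (rule eq_matI)
    fix i s assume "i < dim_row (P * D)" "s < dim_col (P * D)"
    then have i: "i < m" and s: "s < m" using P D by auto
    have "(?M * P) $$ (i, s) = (\<Sum>j<m. a i j * v s j) / mu i"
      using i s by (simp add: P_def scalar_prod_def atLeast0LessThan sum_divide_distrib)
    also have "\<dots> = lam s * v s i" using eig[OF s i] mu[OF i] by simp
    also have "\<dots> = (P * D) $$ (i, s)"
      using i s by (simp add: P_def D_def scalar_prod_def atLeast0LessThan if_distrib cong: if_cong)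
    finally show "(?M * P) $$ (i, s) = (P * D) $$ (i, s)" .
  qed (use P D in auto)
  have "?M = ?M * (P * Q)" using PQ M by simp
  also have "\<dots> = P * D * Q" using MP assoc_mult_mat[OF M P Q] by simp
  finally have "similar_mat_wit ?M D P Q"
    by (intro similar_mat_witI[OF PQ QP _ M D P Q])
  then have "char_poly ?M = char_poly D" by (intro char_poly_similar) (auto simp: similar_mat_def)
  also have "\<dots> = (\<Prod>a \<leftarrow> diag_mat D. [:- a, 1:])"
    by (rule char_poly_upper_triangular[OF D]) (auto simp: D_def)
  also have "diag_mat D = map lam [0..<m]" by (auto simp: diag_mat_def D_def)
  finally have "proots (char_poly ?M) = (\<Sum>p \<leftarrow> map (\<lambda>a. [:- a, 1:]) (map lam [0..<m]). proots p)"
    by (subst proots_prod_list[symmetric]) auto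
  also have "\<dots> = mset (map lam [0..<m])" by (induction m) auto
  finally have "sorted_list_of_multiset (proots (char_poly ?M)) = sort (map lam [0..<m])"
    by (simp only: sorted_list_of_multiset_mset)
  also have "\<dots> = map lam [0..<m]"
    by (rule sorted_sort_id) (use mono in \<open>auto simp: sorted_iff_nth_mono\<close>)
  finally show ?thesis using k by (simp add: eig_def)
qed

text \<open>The last two facts are the halves of the Courant-Fischer principle: a lower bound on the
  complement of the first \<open>s\<close> eigenvectors, an upper bound on the span of the first
  \<open>s + 1\<close>.\<close>

lemma spectral_theorem_weighted:
  fixes m :: nat and mu :: "nat \<Rightarrow> real"
  assumes sym: "\<And>i j. i < m \<Longrightarrow> j < m \<Longrightarrow> a i j = a j i" and mu: "\<And>i. i < m \<Longrightarrow> mu i > 0"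
  obtains v lam where
    "\<And>s t. s < m \<Longrightarrow> t < m \<Longrightarrow> wip m mu (v s) (v t) = (if s = t then 1 else 0)"
    "\<And>k. 1 \<le> k \<Longrightarrow> k \<le> m \<Longrightarrow> eig (mat m m (\<lambda>(i, j). a i j / mu i)) k = lam (k - 1)"
    "\<And>s g. s < m \<Longrightarrow> (\<And>t. t < s \<Longrightarrow> wip m mu (v t) g = 0) \<Longrightarrow> lam s * wip m mu g g \<le> qform m a g g"
    "\<And>s g c. s < m \<Longrightarrow> (\<And>i. i < m \<Longrightarrow> g i = (\<Sum>t\<le>s. c t * v t i)) \<Longrightarrow> qform m a g g \<le> lam s * wip m mu g g"
proof -
  have "\<exists>v lam. (\<forall>s<m. \<forall>t<m. wip m mu (v s) (v t) = (if s = t then 1 else 0)) \<and>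
     (\<forall>s<m. \<forall>i<m. (\<Sum>j<m. a i j * v s j) = lam s * mu i * v s i) \<and>
     (\<forall>s<m. \<forall>g. (\<forall>t<s. wip m mu (v t) g = 0) \<longrightarrow> lam s * wip m mu g g \<le> qform m a g g)"
    by (rule orthonormal_eigenvectors) (fact sym mu order.refl)+
  then obtain v lam where
    ex: "(\<forall>s<m. \<forall>t<m. wip m mu (v s) (v t) = (if s = t then 1 else 0)) \<and>
     (\<forall>s<m. \<forall>i<m. (\<Sum>j<m. a i j * v s j) = lam s * mu i * v s i) \<and>
     (\<forall>s<m. \<forall>g. (\<forall>t<s. wip m mu (v t) g = 0) \<longrightarrow> lam s * wip m mu g g \<le> qform m a g g)"
    by (elim exE)
  have v: "\<And>s t. s < m \<Longrightarrow> t < m \<Longrightarrow> wip m mu (v s) (v t) = (if s = t then 1 else 0)"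
     "\<And>s i. s < m \<Longrightarrow> i < m \<Longrightarrow> (\<Sum>j<m. a i j * v s j) = lam s * mu i * v s i"
     "\<And>s g. s < m \<Longrightarrow> (\<And>t. t < s \<Longrightarrow> wip m mu (v t) g = 0) \<Longrightarrow> lam s * wip m mu g g \<le> qform m a g g"
    using ex by simp_all
  have mono: "lam s \<le> lam t" if "s \<le> t" "t < m" for s t
  proof -
    \<comment> \<open>\<open>v t\<close> is orthogonal to all eigenvectors before \<open>s\<close>,
      so it competes in the minimization behind \<open>lam s\<close>.\<close>
    have "lam s * wip m mu (v t) (v t) \<le> qform m a (v t) (v t)"
      using that v(1) by (intro v(3)) auto
    also have "\<dots> \<le> lam t * wip m mu (v t) (v t)"
    proof (rule qform_eigenvector_span_le[where T = "{t}" and c = "\<lambda>_. 1" and v = v and lam = lam])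
    qed (use that v in auto)
    finally show ?thesis using v(1) that by simp
  qed
  show thesis
  proof (rule that[of v lam])
    show "eig (mat m m (\<lambda>(i, j). a i j / mu i)) k = lam (k - 1)" if "1 \<le> k" "k \<le> m" for k
    proof (rule eig_mat_eigenvectors)
    qed (fact mu v mono that)+
    show "qform m a g g \<le> lam s * wip m mu g g"
      if "s < m" "\<And>i. i < m \<Longrightarrow> g i = (\<Sum>t\<le>s. c t * v t i)" for s g c
    proof (rule qform_eigenvector_span_le)
      show "{..s} \<subseteq> {..<m}" using that(1) by auto
      show "lam t \<le> lam s" if "t \<in> {..s}" for t using that \<open>s < m\<close> by (intro mono) auto
    qed (fact v that)+
  qed (use v in auto)
qed

section \<open>Genus\<close>

lemma rvec_mono: "k \<le> l \<Longrightarrow> rvec k \<subseteq> rvec l"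
  by (auto simp: rvec_def)

lemma genus_le: "odd_map_into B k \<Longrightarrow> genus B \<le> k"
  unfolding genus_def by (rule Least_le)

lemma odd_map_into_mono: "odd_map_into B k \<Longrightarrow> k \<le> l \<Longrightarrow> odd_map_into B l"
  unfolding odd_map_into_def using rvec_mono[of k l] by blast

lemma sphere_p_nonzero: "f \<in> sphere_p n mu p \<Longrightarrow> f \<noteq> (\<lambda>_. 0)"
  by (auto simp: sphere_p_def)

text \<open>The identity is a witness, so the \<open>LEAST\<close> in \<open>genus\<close> is
  attained for subsets of a sphere.\<close>

lemma odd_map_into_sphere_subset:
  assumes "B \<subseteq> sphere_p n mu p" shows "odd_map_into B n"
  unfolding odd_map_into_def
  using assms sphere_p_nonzero by (intro exI[of _ id]) (auto simp: sphere_p_def)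

lemma odd_map_into_genus:
  assumes "B \<subseteq> sphere_p n mu p" shows "odd_map_into B (genus B)"
  unfolding genus_def using odd_map_into_sphere_subset[OF assms] by (rule LeastI)

text \<open>Odd functionals without a common zero would be the coordinates of an odd map into the
  nonzero vectors of \<open>rvec r\<close>, bounding the genus by \<open>r\<close>.\<close>

lemma genus_common_zero:
  fixes L :: "nat \<Rightarrow> (nat \<Rightarrow> real) \<Rightarrow> real"
  assumes genus: "genus B > r"
    and cont: "\<And>i. i < r \<Longrightarrow> continuous_on B (L i)"
    and odd: "\<And>i f. i < r \<Longrightarrow> f \<in> B \<Longrightarrow> L i (\<lambda>i. - f i) = - L i f"
  obtains f where "f \<in> B" "\<And>i. i < r \<Longrightarrow> L i f = 0"
proof -
  have "\<exists>f\<in>B. \<forall>i<r. L i f = 0"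
  proof (rule ccontr)
    assume no: "\<not> ?thesis"
    define h where "h f = (\<lambda>i. if i < r then L i f else 0)" for f
    have 1: "continuous_on B h"
    proof (rule continuous_on_coordinatewise_then_product)
      show "continuous_on B (\<lambda>f. h f i)" for i
        unfolding h_def using cont by (cases "i < r") auto
    qed
    have 2: "\<forall>f\<in>B. h (\<lambda>i. - f i) = (\<lambda>i. - h f i)"
      using odd by (auto simp: h_def)
    have "h f \<in> rvec r - {\<lambda>_. 0}" if "f \<in> B" for f
    proof -
      obtain i where "i < r" "L i f \<noteq> 0" using no \<open>f \<in> B\<close> by blast
      then have "h f i \<noteq> 0" by (simp add: h_def)
      then have "h f \<noteq> (\<lambda>_. 0)" by (rule contrapos_nn) (simp only:)
      then show ?thesis by (simp add: rvec_def h_def)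
    qed
    then have "h ` B \<subseteq> rvec r - {\<lambda>_. 0}" by (rule image_subsetI)
    with 1 2 have "odd_map_into B r" unfolding odd_map_into_def by (intro exI[of _ h] conjI)
    then show False using genus_le genus by fastforce
  qed
  then show ?thesis using that by blast
qed

lemma genus_pos_nonempty: "genus B > 0 \<Longrightarrow> B \<noteq> {}"
  by (metis equals0D genus_common_zero less_nat_zero_code)

lemma sphere_p_2: "sphere_p n mu 2 = {f \<in> rvec n. (\<Sum>i<n. mu i * (f i)\<^sup>2) = 1}"
  by (simp add: sphere_p_def)

lemma closed_rvec: "closed (rvec n)"
proof -
  have "closed {x::nat \<Rightarrow> real. x i = 0}" for i
    by (intro closed_Collect_eq continuous_intros continuous_on_product_coordinates)
  then have "closed (\<Inter>i\<in>{n..}. {x::nat \<Rightarrow> real. x i = 0})" by blast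
  also have "\<dots> = rvec n" by (auto simp: rvec_def)
  finally show ?thesis .
qed

text \<open>Scaling coordinate \<open>i\<close> by \<open>1 / sqrt (mu i)\<close> carries
  \<open>usphere (n - 1)\<close> into the weighted sphere, so an odd map of the latter into fewer
  than \<open>n\<close> dimensions has a zero by \<open>Borsuk_Ulam\<close>.\<close>

lemma genus_sphere_ge:
  assumes mu: "\<And>i. i < n \<Longrightarrow> mu i > 0"
  shows "genus (sphere_p n mu 2) \<ge> n"
proof (rule ccontr)
  assume "\<not> ?thesis"
  then have lt: "genus (sphere_p n mu 2) < n" by simp
  then obtain m where n: "n = Suc m" by (cases n) auto
  have "odd_map_into (sphere_p n mu 2) m"
    using odd_map_into_genus[of "sphere_p n mu 2" n mu 2] odd_map_into_mono lt n by auto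
  then obtain h where h: "continuous_on (sphere_p n mu 2) h"
    "\<And>f. f \<in> sphere_p n mu 2 \<Longrightarrow> h (\<lambda>i. - f i) = (\<lambda>i. - h f i)"
    "\<And>f. f \<in> sphere_p n mu 2 \<Longrightarrow> h f \<in> rvec m - {\<lambda>_. 0}"
    unfolding odd_map_into_def by blast
  define S where "S x = (\<lambda>i. if i < n then x i / sqrt (mu i) else 0)" for x :: "nat \<Rightarrow> real"
  have S_in: "S x \<in> sphere_p n mu 2" if "x \<in> usphere m" for x
  proof -
    have "(\<Sum>i<n. mu i * (S x i)\<^sup>2) = (\<Sum>i<n. (x i)\<^sup>2)"
      using mu by (intro sum.cong) (auto simp: S_def power_divide less_imp_le less_imp_neq[symmetric])
    then show ?thesis
      using that by (auto simp: sphere_p_2 usphere_def rvec_def S_def n lessThan_Suc_atMost)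
  qed
  have "continuous_on (usphere m) (\<lambda>x. h (S x))"
  proof (rule continuous_on_compose2[OF h(1)])
    have c: "continuous_on (usphere m) (\<lambda>x. x i)" for i
      by (rule continuous_on_subset[OF continuous_on_product_coordinates]) simp
    show "continuous_on (usphere m) S"
    proof (rule continuous_on_coordinatewise_then_product)
      show "continuous_on (usphere m) (\<lambda>x. S x i)" for i
        unfolding S_def using mu[of i] by (cases "i < n") (auto intro!: continuous_intros c)
    qed
  qed (use S_in in blast)
  moreover have "h (S (\<lambda>i. - x i)) = (\<lambda>i. - h (S x) i)" if "x \<in> usphere m" for x
  proof -
    have "S (\<lambda>i. - x i) = (\<lambda>i. - S x i)" by (auto simp: S_def)
    then show ?thesis using h(2)[OF S_in[OF that]] by simp
  qed
  ultimately obtain x where x: "x \<in> usphere m" "\<forall>i<m. h (S x) i = 0"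
    using Borsuk_Ulam[of m "\<lambda>x. h (S x)"] by blast
  then have "h (S x) = (\<lambda>_. 0)"
    using h(3)[OF S_in[OF x(1)]] by (auto simp: rvec_def not_less fun_eq_iff) (metis not_le)
  then show False using h(3)[OF S_in[OF x(1)]] by simp
qed

lemma sphere_in_genus_family:
  assumes mu: "\<And>i. i < n \<Longrightarrow> mu i > 0" and k: "k \<le> n"
  shows "sphere_p n mu 2 \<in> genus_family n mu 2 k"
proof -
  have "closed {f::nat \<Rightarrow> real. (\<Sum>i<n. mu i * (f i)\<^sup>2) = 1}"
    by (intro closed_Collect_eq continuous_intros continuous_on_product_coordinates)
  then have "closed (rvec n \<inter> {f. (\<Sum>i<n. mu i * (f i)\<^sup>2) = 1})"
    by (intro closed_Int closed_rvec)
  also have "rvec n \<inter> {f. (\<Sum>i<n. mu i * (f i)\<^sup>2) = 1} = sphere_p n mu 2" by (auto simp: sphere_p_2)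
  finally have "closed (sphere_p n mu 2)" .
  moreover have neg: "(\<lambda>i. - f i) \<in> sphere_p n mu 2" if "f \<in> sphere_p n mu 2" for f
    using that by (simp add: sphere_p_2 rvec_def)
  then have "(\<lambda>f i. - f i) ` sphere_p n mu 2 = sphere_p n mu 2"
    by (auto simp: image_iff intro!: bexI[OF _ neg])
  ultimately show ?thesis
    using genus_sphere_ge[of n mu, OF mu] k by (simp add: genus_family_def)
qed

section \<open>The limit of the rescaled Rayleigh quotients\<close>

text \<open>The signed power. Both bases are nonnegative, so continuity at 0 comes from that of
  \<open>powr\<close> with positive exponent.\<close>

definition spow :: "real \<Rightarrow> real \<Rightarrow> real" where
  "spow r x = max 0 x powr r - max 0 (- x) powr r"

lemma spow_uminus: "spow r (- x) = - spow r x"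
  by (simp add: spow_def)

lemma spow_nonneg_eq: "x \<ge> 0 \<Longrightarrow> spow r x = x powr r"
  by (simp add: spow_def max_def)

lemma spow_nonpos_eq: "x \<le> 0 \<Longrightarrow> spow r x = - ((- x) powr r)"
  by (simp add: spow_def max_def)

lemma abs_spow: "\<bar>spow r x\<bar> = \<bar>x\<bar> powr r"
  by (cases "x \<ge> 0") (auto simp: spow_nonneg_eq spow_nonpos_eq)

lemma spow_spow: "r > 0 \<Longrightarrow> s > 0 \<Longrightarrow> spow r (spow s x) = spow (s * r) x"
  by (cases "x \<ge> 0") (auto simp: spow_nonneg_eq spow_nonpos_eq spow_uminus powr_powr)

lemma spow_1: "spow 1 x = x"
  by (cases "x \<ge> 0") (auto simp: spow_nonneg_eq spow_nonpos_eq)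

lemma continuous_on_spow:
  assumes "r > 0" "continuous_on X f" shows "continuous_on X (\<lambda>x. spow r (f x))"
  unfolding spow_def using assms by (intro continuous_intros continuous_on_powr') auto

lemma continuous_on_spow_coordinatewise:
  "r > 0 \<Longrightarrow> continuous_on X (\<lambda>f i. spow r (f i))" for X :: "(nat \<Rightarrow> real) set"
  by (intro continuous_on_coordinatewise_then_product continuous_on_spow
      continuous_on_subset[OF continuous_on_product_coordinates]) auto

lemma spow_sphere_p:
  assumes "p > 0" "q > 0" "f \<in> sphere_p n mu p"
  shows "(\<lambda>i. spow (p / q) (f i)) \<in> sphere_p n mu q"
proof -
  have "\<bar>spow (p / q) x\<bar> powr q = \<bar>x\<bar> powr p" for x
    using assms by (simp add: abs_spow powr_powr)
  then show ?thesis using assms by (simp add: sphere_p_def rvec_def spow_def)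
qed

text \<open>The signed power with exponent \<open>q / p\<close> is inverse, so the image of
  \<open>B\<close> is a preimage under a continuous map and hence closed. An odd map on the image
  composes to one on \<open>B\<close>, so the genus cannot drop.\<close>

lemma spow_genus_family:
  assumes pq: "p > 0" "q > 0" and B: "B \<in> genus_family n mu p k"
  shows "(\<lambda>f i. spow (p / q) (f i)) ` B \<in> genus_family n mu q k"
proof -
  let ?F = "\<lambda>(f :: nat \<Rightarrow> real) i. spow (p / q) (f i)" and ?G = "\<lambda>(f :: nat \<Rightarrow> real) i. spow (q / p) (f i)"
  have r: "p / q > 0" "q / p > 0" using pq by auto
  have gf: "spow (q / p) (spow (p / q) x) = x" and fg: "spow (p / q) (spow (q / p) x) = x" for x
    using pq by (simp_all add: spow_spow spow_1)
  have sub: "B \<subseteq> sphere_p n mu p" and cl: "closed B" and sym: "(\<lambda>f i. - f i) ` B = B" and gen: "genus B \<ge> k"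
    using B by (auto simp: genus_family_def)
  have sub': "?F ` B \<subseteq> sphere_p n mu q" using sub spow_sphere_p[OF pq] by blast
  have "?F ` B = ?G -` B"
  proof (intro equalityI subsetI)
    fix g assume "g \<in> ?G -` B"
    then have "?G g \<in> B" by (rule vimageD)
    moreover have "g = ?F (?G g)" by (simp only: fg)
    ultimately show "g \<in> ?F ` B" by (intro image_eqI[of _ ?F "?G g"])
  qed (auto simp: gf)
  moreover have "closed (?G -` B)"
    using cl continuous_on_spow_coordinatewise[OF r(2)] by (rule closed_vimage)
  ultimately have "closed (?F ` B)" by (simp only:)
  moreover have "(\<lambda>f i. - f i) ` ?F ` B = ?F ` B"
  proof -
    have "(\<lambda>f i. - f i) ` ?F ` B = ?F ` (\<lambda>f i. - f i) ` B"
      unfolding image_image by (simp add: spow_uminus)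
    then show ?thesis unfolding sym .
  qed
  moreover have "genus B \<le> genus (?F ` B)"
  proof (rule genus_le)
    obtain h where h: "continuous_on (?F ` B) h" "\<forall>f\<in>?F ` B. h (\<lambda>i. - f i) = (\<lambda>i. - h f i)"
      "h ` ?F ` B \<subseteq> rvec (genus (?F ` B)) - {\<lambda>_. 0}"
      using odd_map_into_genus[OF sub'] unfolding odd_map_into_def by blast
    have "continuous_on B (\<lambda>f. h (?F f))"
      using continuous_on_compose[OF continuous_on_spow_coordinatewise[OF r(1)] h(1)] by (simp add: o_def)
    moreover have "\<forall>f\<in>B. h (?F (\<lambda>i. - f i)) = (\<lambda>i. - h (?F f) i)"
      using h(2) by (simp add: spow_uminus)
    moreover have "(\<lambda>f. h (?F f)) ` B \<subseteq> rvec (genus (?F ` B)) - {\<lambda>_. 0}"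
      using h(3) by (simp add: image_image)
    ultimately show "odd_map_into B (genus (?F ` B))"
      unfolding odd_map_into_def by (intro exI[of _ "\<lambda>f. h (?F f)"]) blast
  qed
  ultimately show ?thesis using sub' gen by (simp add: genus_family_def)
qed

lemma INF_SUP_genus_family_spow:
  fixes R :: "(nat \<Rightarrow> real) \<Rightarrow> real"
  assumes pq: "p > 0" "q > 0"
  shows "(INF B\<in>genus_family n mu p k. SUP f\<in>B. R f) =
    (INF B\<in>genus_family n mu q k. SUP f\<in>B. R (\<lambda>i. spow (q / p) (f i)))"
proof -
  let ?F = "\<lambda>(f :: nat \<Rightarrow> real) i. spow (p / q) (f i)" and ?G = "\<lambda>(f :: nat \<Rightarrow> real) i. spow (q / p) (f i)"
  have gf: "spow (q / p) (spow (p / q) x) = x" for x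
    using pq by (simp add: spow_spow spow_1)
  have "(\<lambda>B. SUP f\<in>B. R f) ` genus_family n mu p k = (\<lambda>B. SUP f\<in>B. R (?G f)) ` genus_family n mu q k"
  proof (intro equalityI subsetI; elim imageE)
    fix x B assume "x = (SUP f\<in>B. R f)" "B \<in> genus_family n mu p k"
    then show "x \<in> (\<lambda>B. SUP f\<in>B. R (?G f)) ` genus_family n mu q k"
      using spow_genus_family[OF pq] by (intro image_eqI[of _ _ "?F ` B"]) (simp_all add: image_image gf)
  next
    fix x B assume "x = (SUP f\<in>B. R (?G f))" "B \<in> genus_family n mu q k"
    then show "x \<in> (\<lambda>B. SUP f\<in>B. R f) ` genus_family n mu p k"
      using spow_genus_family[OF pq(2,1)] by (intro image_eqI[of _ _ "?G ` B"]) (simp_all add: image_image)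
  qed
  then show ?thesis by (simp only:)
qed

text \<open>With a factor and an error term, both directions of the later comparison are instances,
  for \<open>c = 2 powr p\<close> and \<open>c = 2 powr (- p)\<close>. The bounds make the suprema
  and infima of reals meaningful.\<close>

lemma INF_SUP_le_affine:
  fixes F G :: "'a \<Rightarrow> real"
  assumes ne: "\<B> \<noteq> {}" "\<And>B. B \<in> \<B> \<Longrightarrow> B \<noteq> {}" and S: "\<And>B. B \<in> \<B> \<Longrightarrow> B \<subseteq> S"
    and bF: "\<And>f. f \<in> S \<Longrightarrow> \<bar>F f\<bar> \<le> K" and bG: "\<And>f. f \<in> S \<Longrightarrow> \<bar>G f\<bar> \<le> L"
    and c: "c > 0" and le: "\<And>f. f \<in> S \<Longrightarrow> F f \<le> c * G f + e"
  shows "(INF B\<in>\<B>. SUP f\<in>B. F f) \<le> c * (INF B\<in>\<B>. SUP f\<in>B. G f) + e"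
proof -
  have bdd: "bdd_above (F ` B)" "bdd_above (G ` B)" if "B \<in> \<B>" for B
    using S[OF that] bF bG by (meson abs_le_D1 bdd_above.I2 subsetD)+
  have below: "bdd_below ((\<lambda>B. SUP f\<in>B. F f) ` \<B>)"
  proof (rule bdd_belowI2)
    fix B assume B: "B \<in> \<B>"
    then obtain f where f: "f \<in> B" using ne by blast
    then have "- K \<le> F f" using bF S[OF B] by (metis abs_le_D2 minus_le_iff subsetD)
    also have "\<dots> \<le> (SUP f\<in>B. F f)" using bdd[OF B] f by (intro cSUP_upper) auto
    finally show "- K \<le> (SUP f\<in>B. F f)" .
  qed
  have "((INF B\<in>\<B>. SUP f\<in>B. F f) - e) / c \<le> (INF B\<in>\<B>. SUP f\<in>B. G f)"
  proof (rule cINF_greatest[OF ne(1)])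
    fix B assume B: "B \<in> \<B>"
    have "(INF B\<in>\<B>. SUP f\<in>B. F f) \<le> (SUP f\<in>B. F f)" using below B by (rule cINF_lower)
    also have "\<dots> \<le> c * (SUP f\<in>B. G f) + e"
    proof (rule cSUP_least[OF ne(2)[OF B]])
      fix f assume f: "f \<in> B"
      then have "F f \<le> c * G f + e" using le S[OF B] by blast
      also have "c * G f \<le> c * (SUP f\<in>B. G f)" using bdd[OF B] f c by (intro mult_left_mono cSUP_upper) auto
      finally show "F f \<le> c * (SUP f\<in>B. G f) + e" by simp
    qed
    finally show "((INF B\<in>\<B>. SUP f\<in>B. F f) - e) / c \<le> (SUP f\<in>B. G f)"
      using c by (simp add: pos_divide_le_eq mult.commute)
  qed
  then show ?thesis using c by (simp add: pos_divide_le_eq mult.commute)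
qed

text \<open>The point is a bound free of \<open>s\<close>. With \<open>u = (1 - s) / 2\<close>, the
  squared arithmetic mean of 1 and \<open>s\<close> exceeds \<open>s\<close> by
  \<open>u\<^sup>2\<close>; the mean value theorem gives the error
  \<open>q * (u\<^sup>2 * (1 - u) powr (2 * (q - 1)))\<close>, and
  \<open>1 - u \<le> exp (- u)\<close> with \<open>z * exp (- z) \<le> 1\<close> at
  \<open>z = u * (q - 1)\<close> bounds it.\<close>

lemma power_mean_to_geometric_mean:
  fixes s q :: real
  assumes s: "0 \<le> s" "s \<le> 1" and q: "q > 1"
  shows "s powr q \<le> ((1 + s) / 2) powr (2 * q)" 
    and "((1 + s) / 2) powr (2 * q) \<le> s powr q + q / (q - 1)\<^sup>2"
proof -
  define u where "u = (1 - s) / 2"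
  define b where "b = ((1 + s) / 2)\<^sup>2"
  have u: "0 \<le> u" "u \<le> 1/2" using s by (auto simp: u_def)
  have bs: "b - s = u\<^sup>2" by (simp add: b_def u_def power2_eq_square field_simps)
  then have "s \<le> b" by (metis diff_ge_0_iff_ge zero_le_power2)
  have b: "b > 0" "b = (1 - u)\<^sup>2" using s by (auto simp: b_def u_def field_simps)
  have bq: "((1 + s) / 2) powr (2 * q) = b powr q"
    unfolding b_def using s by (simp add: powr_powr flip: powr_numeral)
  show "s powr q \<le> ((1 + s) / 2) powr (2 * q)"
    unfolding bq using s \<open>s \<le> b\<close> q by (intro powr_mono2) auto
  have "b powr q - s powr q \<le> (b - s) * (q * b powr (q - 1))"
  \<comment> \<open>The mean value theorem is applied with the derivative of \<open>powr\<close> on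
    the closed interval, so its left end must not be 0; at \<open>s = b\<close> the interval
    degenerates.\<close>
  proof (cases "s = 0 \<or> s = b")
    case True
    then show ?thesis
    proof
      assume "s = 0"
      then have "(b - s) * (q * b powr (q - 1)) = q * (b * b powr (q - 1))" by simp
      also have "b * b powr (q - 1) = b powr q" using b by (simp add: powr_mult_base)
      finally have "(b - s) * (q * b powr (q - 1)) = q * b powr q" .
      moreover have "1 * b powr q \<le> q * b powr q" using q by (intro mult_right_mono) auto
      moreover have "s powr q = 0" using \<open>s = 0\<close> by simp
      ultimately show ?thesis by linarith
    qed simp
  next
    case False
    then have "s < b" "0 < s" using \<open>s \<le> b\<close> s by auto
    have "\<exists>z>s. z < b \<and> b powr q - s powr q = (b - s) * (q * z powr (q - 1))"
      by (rule MVT2[OF \<open>s < b\<close>]) (use \<open>0 < s\<close> in \<open>auto intro!: derivative_eq_intros\<close>)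
    then obtain z where z: "s < z" "z < b" "b powr q - s powr q = (b - s) * (q * z powr (q - 1))" by blast
    have "z powr (q - 1) \<le> b powr (q - 1)" using z \<open>0 < s\<close> q by (intro powr_mono2) auto
    then show ?thesis unfolding z(3) using \<open>s < b\<close> q by (intro mult_left_mono) auto
  qed
  also have "\<dots> = q * (u\<^sup>2 * (1 - u) powr (2 * (q - 1)))"
  proof -
    have "b powr (q - 1) = (1 - u) powr (2 * (q - 1))"
      unfolding b(2) using u by (simp add: powr_powr flip: powr_numeral)
    then show ?thesis by (simp add: bs)
  qed
  also have "\<dots> \<le> q * (1 / (q - 1)\<^sup>2)"
  proof (rule mult_left_mono)
    have "(1 - u) powr (2 * (q - 1)) \<le> exp (- u) powr (2 * (q - 1))"
      using u q exp_ge_add_one_self[of "- u"] by (intro powr_mono2) auto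
    also have "\<dots> = exp (- (u * (q - 1))) ^ 2"
      by (simp add: powr_def exp_double algebra_simps flip: exp_of_nat_mult)
    finally have 1: "(1 - u) powr (2 * (q - 1)) \<le> (exp (- (u * (q - 1))))\<^sup>2" .
    have "z * exp (- z) \<le> 1" for z :: real
    proof -
      have "z \<le> exp z" using exp_ge_add_one_self[of z] by linarith
      then show ?thesis by (simp add: exp_minus field_simps)
    qed
    then have "u * (q - 1) * exp (- (u * (q - 1))) \<le> 1" .
    then have "(u * (q - 1) * exp (- (u * (q - 1))))\<^sup>2 \<le> 1"
      using u q by (simp add: power_le_one)
    then have 2: "u\<^sup>2 * (exp (- (u * (q - 1))))\<^sup>2 * (q - 1)\<^sup>2 \<le> 1"
      by (simp add: power_mult_distrib mult_ac)
    have "u\<^sup>2 * (1 - u) powr (2 * (q - 1)) * (q - 1)\<^sup>2 \<le> u\<^sup>2 * (exp (- (u * (q - 1))))\<^sup>2 * (q - 1)\<^sup>2"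
      using 1 by (intro mult_right_mono mult_left_mono) auto
    with 2 have "u\<^sup>2 * (1 - u) powr (2 * (q - 1)) * (q - 1)\<^sup>2 \<le> 1" by linarith
    then show "u\<^sup>2 * (1 - u) powr (2 * (q - 1)) \<le> 1 / (q - 1)\<^sup>2"
      using q by (simp add: pos_le_divide_eq)
  qed (use q in simp)
  finally show "((1 + s) / 2) powr (2 * q) \<le> s powr q + q / (q - 1)\<^sup>2"
    unfolding bq by simp
qed

text \<open>Everything is homogeneous of degree 2, so division by \<open>x\<close> reduces to
  \<open>power_mean_to_geometric_mean\<close> with \<open>q = p / 2\<close>; \<open>s\<close> is
  chosen to make \<open>s powr (p / 2) = y / x\<close>.\<close>

lemma cutoff_edge_estimate_pos:
  fixes x y p :: real
  assumes xy: "0 \<le> y" "y \<le> x" and p: "p > 2"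
  shows "\<bar>2 powr (- p) * (x powr (2 / p) + y powr (2 / p)) powr p - x * y\<bar> \<le> (p / 2) / (p / 2 - 1)\<^sup>2 * x\<^sup>2"
proof (cases "x = 0")
  case False
  then have x: "x > 0" using xy by simp
  define s where "s = (y / x) powr (2 / p)"
  have s: "0 \<le> s" "s \<le> 1" using xy x p by (auto simp: s_def intro!: powr_le1)
  have sq: "s powr (p / 2) = y / x" using xy x p by (simp add: s_def powr_powr)
  have "x powr (2 / p) + y powr (2 / p) = x powr (2 / p) * (1 + s)"
    using xy x by (simp add: s_def powr_divide field_simps)
  then have "(x powr (2 / p) + y powr (2 / p)) powr p = x\<^sup>2 * (1 + s) powr p"
    using x s p by (simp add: powr_mult powr_powr)
  moreover have "((1 + s) / 2) powr p = (1 + s) powr p * 2 powr (- p)"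
    using s by (simp add: powr_divide powr_minus field_simps)
  ultimately have "2 powr (- p) * (x powr (2 / p) + y powr (2 / p)) powr p = x\<^sup>2 * ((1 + s) / 2) powr p"
    by simp
  moreover have "x * y = x\<^sup>2 * s powr (p / 2)" using x by (simp add: sq power2_eq_square)
  ultimately have "2 powr (- p) * (x powr (2 / p) + y powr (2 / p)) powr p - x * y
      = (((1 + s) / 2) powr p - s powr (p / 2)) * x\<^sup>2" by (simp add: algebra_simps)
  then have "\<bar>2 powr (- p) * (x powr (2 / p) + y powr (2 / p)) powr p - x * y\<bar>
      = \<bar>((1 + s) / 2) powr p - s powr (p / 2)\<bar> * x\<^sup>2" by (simp add: abs_mult)
  also have "\<dots> \<le> (p / 2) / (p / 2 - 1)\<^sup>2 * x\<^sup>2"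
  proof (rule mult_right_mono)
    have "2 * (p / 2) = p" "p / 2 > 1" using p by auto
    then show "\<bar>((1 + s) / 2) powr p - s powr (p / 2)\<bar> \<le> (p / 2) / (p / 2 - 1)\<^sup>2"
      using power_mean_to_geometric_mean[OF s, of "p / 2"] unfolding abs_le_iff by auto
  qed simp
  finally show ?thesis .
qed (use xy in auto)

text \<open>The two terms of the constant belong to two cases. Equal signs give the power mean
  error. For opposite signs the signed powers partly cancel, the \<open>p\<close>-th power of their
  sum is at most the larger square, and the factor \<open>2 powr (- p)\<close> makes this small.
  Swapping and negating both arguments reduce the rest to these cases.\<close>

lemma cutoff_edge_estimate:
  fixes x y p :: real
  assumes p: "p > 2"
  shows "\<bar>2 powr (- p) * \<bar>spow (2 / p) x + spow (2 / p) y\<bar> powr p - max 0 (x * y)\<bar>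
    \<le> (2 powr (- p) + (p / 2) / (p / 2 - 1)\<^sup>2) * max (x\<^sup>2) (y\<^sup>2)"
    (is "?L x y \<le> ?d * _")
proof -
  have sym: "?L x y = ?L y x" for x y
    by (simp only: add.commute[of "spow (2 / p) x"] mult.commute[of x])
  have neg: "?L (- x) (- y) = ?L x y" for x y
  proof -
    have "spow (2 / p) (- x) + spow (2 / p) (- y) = - (spow (2 / p) x + spow (2 / p) y)"
      by (simp add: spow_uminus)
    then show ?thesis by (simp only: abs_minus_cancel minus_mult_minus)
  qed
  have d: "(p / 2) / (p / 2 - 1)\<^sup>2 \<le> ?d" "2 powr (- p) \<le> ?d" using p by auto
  have same: "?L x y \<le> ?d * max (x\<^sup>2) (y\<^sup>2)" if "0 \<le> y" "y \<le> x" for x y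
  proof -
    have "?L x y \<le> (p / 2) / (p / 2 - 1)\<^sup>2 * x\<^sup>2"
      using cutoff_edge_estimate_pos[OF that p] that by (simp add: spow_nonneg_eq)
    also have "\<dots> \<le> ?d * max (x\<^sup>2) (y\<^sup>2)"
      using d p by (intro mult_mono) auto
    finally show ?thesis .
  qed
  have opp: "?L x y \<le> ?d * max (x\<^sup>2) (y\<^sup>2)" if "y \<le> 0" "0 \<le> x" for x y
  proof -
    let ?a = "spow (2 / p) x" and ?b = "spow (2 / p) y"
    have pow: "\<bar>spow (2 / p) z\<bar> powr p = z\<^sup>2" for z
      using p by (simp add: abs_spow powr_powr)
    have "0 \<le> ?a" "?b \<le> 0" using that by (simp_all add: spow_nonneg_eq spow_nonpos_eq)
    then consider "\<bar>?a + ?b\<bar> \<le> \<bar>?a\<bar>" | "\<bar>?a + ?b\<bar> \<le> \<bar>?b\<bar>" by linarith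
    then have "\<bar>?a + ?b\<bar> powr p \<le> max (x\<^sup>2) (y\<^sup>2)"
    proof cases
      case 1
      then have "\<bar>?a + ?b\<bar> powr p \<le> \<bar>?a\<bar> powr p" using p by (intro powr_mono2) simp_all
      then show ?thesis unfolding pow by (rule max.coboundedI1)
    next
      case 2
      then have "\<bar>?a + ?b\<bar> powr p \<le> \<bar>?b\<bar> powr p" using p by (intro powr_mono2) simp_all
      then show ?thesis unfolding pow by (rule max.coboundedI2)
    qed
    then have "2 powr (- p) * \<bar>?a + ?b\<bar> powr p \<le> ?d * max (x\<^sup>2) (y\<^sup>2)"
      by (rule mult_mono[OF d(2)]) (rule order_trans[OF powr_ge_zero d(2)], rule powr_ge_zero)
    moreover have "max 0 (x * y) = 0" using that by (simp add: mult_nonneg_nonpos)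
    ultimately show ?thesis by simp
  qed
  have nonneg: "?L x y \<le> ?d * max (x\<^sup>2) (y\<^sup>2)" if "0 \<le> x" for x y
  proof -
    consider "y \<le> 0" | "0 \<le> y" "y \<le> x" | "x \<le> y" by linarith
    then show ?thesis
    proof cases
      case 3
      have "?L y x \<le> ?d * max (y\<^sup>2) (x\<^sup>2)" by (rule same) (fact that 3)+
      then show ?thesis unfolding sym[of y x] max.commute[of "y\<^sup>2"] .
    next
      case 1
      then show ?thesis using that by (rule opp)
    next
      case 2
      then show ?thesis by (rule same)
    qed
  qed
  show ?thesis
  proof (cases "0 \<le> x")
    case False
    then have "0 \<le> - x" by simp
    have "?L x y = ?L (- x) (- y)" by (rule neg[symmetric])
    also have "\<dots> \<le> ?d * max ((- x)\<^sup>2) ((- y)\<^sup>2)" using \<open>0 \<le> - x\<close> by (rule nonneg)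
    finally show ?thesis unfolding power2_minus .
  next
    case True
    then show ?thesis by (rule nonneg)
  qed
qed

section \<open>Quadratic forms of subgraphs\<close>

text \<open>Each edge arises from two ordered pairs; this is the source of the 1/2 in the
  theorem.\<close>

lemma sum_pairs_eq_sum_edges:
  fixes c :: "nat set \<Rightarrow> real"
  assumes V: "finite V" and E: "\<And>e. e \<in> E0 \<Longrightarrow> \<exists>i j. e = {i, j} \<and> i \<noteq> j \<and> i \<in> V \<and> j \<in> V"
  shows "(\<Sum>i\<in>V. \<Sum>j\<in>V. (if {i, j} \<in> E0 then c {i, j} else 0) * g i * g j) =
    2 * (\<Sum>e\<in>E0. c e * g (Min e) * g (Max e))"
proof -
  define P where "P = {x \<in> V \<times> V. {fst x, snd x} \<in> E0}"
  define t where "t x = c {fst x, snd x} * g (fst x) * g (snd x)" for x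
  have "E0 \<subseteq> Pow V" using E by blast
  then have finE: "finite E0" using V by (meson finite_Pow_iff finite_subset)
  have finP: "finite P" using V by (auto simp: P_def)
  have "(\<Sum>i\<in>V. \<Sum>j\<in>V. (if {i, j} \<in> E0 then c {i, j} else 0) * g i * g j) =
      (\<Sum>x\<in>V \<times> V. if {fst x, snd x} \<in> E0 then t x else 0)"
    unfolding sum.cartesian_product by (intro sum.cong) (auto simp: t_def)
  also have "\<dots> = sum t P"
    unfolding P_def using V by (intro sum.inter_filter[symmetric]) auto
  also have "\<dots> = (\<Sum>e\<in>E0. sum t {x \<in> P. {fst x, snd x} = e})"
    by (rule sum.group[symmetric, OF finP finE]) (auto simp: P_def)
  also have "\<dots> = (\<Sum>e\<in>E0. 2 * (c e * g (Min e) * g (Max e)))"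
  proof (rule sum.cong[OF refl])
    fix e assume e: "e \<in> E0"
    then obtain i j where ij: "e = {i, j}" "i < j" "i \<in> V" "j \<in> V"
      using E[OF e] by (metis insert_commute linorder_neqE_nat)
    have m: "Min e = i" "Max e = j" using ij by auto
    have "{x \<in> P. {fst x, snd x} = e} = {(i, j), (j, i)}"
      using ij e by (auto simp: P_def doubleton_eq_iff insert_commute)
    then show "sum t {x \<in> P. {fst x, snd x} = e} = 2 * (c e * g (Min e) * g (Max e))"
      unfolding m using ij by (simp add: t_def insert_commute)
  qed
  finally show ?thesis by (simp add: sum_distrib_left)
qed

definition edge_form :: "nat set set \<Rightarrow> (nat set \<Rightarrow> real) \<Rightarrow> (nat set \<Rightarrow> real) \<Rightarrow> (nat \<Rightarrow> real) \<Rightarrow> real" where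
  "edge_form E0 sg w f = (\<Sum>e\<in>E0. sg e * w e * f (Min e) * f (Max e))"

text \<open>Rows of \<open>norm_adj\<close> are numbered by positions in the sorted list of
  \<open>V0\<close>. The spectral data are carried over to functions on the vertices themselves, so
  that subgraphs with different vertex sets can be compared.\<close>

lemma subgraph_spectral_basis:
  fixes mu :: "nat \<Rightarrow> real"
  assumes fin: "finite V0" and E: "\<And>e. e \<in> E0 \<Longrightarrow> \<exists>i j. e = {i, j} \<and> i \<noteq> j \<and> i \<in> V0 \<and> j \<in> V0"
    and mu: "\<And>i. i \<in> V0 \<Longrightarrow> mu i > 0"
  obtains v lam where
    "\<And>s t. s < card V0 \<Longrightarrow> t < card V0 \<Longrightarrow> (\<Sum>i\<in>V0. mu i * v s i * v t i) = (if s = t then 1 else 0)"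
    "\<And>k. 1 \<le> k \<Longrightarrow> k \<le> card V0 \<Longrightarrow> eig (norm_adj V0 E0 sg w mu) k = lam (k - 1)"
    "\<And>s g. s < card V0 \<Longrightarrow> (\<And>t. t < s \<Longrightarrow> (\<Sum>i\<in>V0. mu i * v t i * g i) = 0) \<Longrightarrow>
       lam s * (\<Sum>i\<in>V0. mu i * (g i)\<^sup>2) \<le> 2 * edge_form E0 sg w g"
    "\<And>s g c. s < card V0 \<Longrightarrow> (\<And>i. i \<in> V0 \<Longrightarrow> g i = (\<Sum>t\<le>s. c t * v t i)) \<Longrightarrow>
       2 * edge_form E0 sg w g \<le> lam s * (\<Sum>i\<in>V0. mu i * (g i)\<^sup>2)"
proof -
  define m where "m = card V0"
  define vs where "vs = sorted_list_of_set V0"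
  define a where "a p q = (if {vs ! p, vs ! q} \<in> E0 then sg {vs ! p, vs ! q} * w {vs ! p, vs ! q} else 0)" for p q
  define nu where "nu p = mu (vs ! p)" for p
  have bij: "bij_betw (\<lambda>p. vs ! p) {..<m} V0"
    unfolding vs_def m_def using fin by (intro bij_betw_nth) auto
  have nu: "nu p > 0" if "p < m" for p
    using bij_betwE[OF bij] mu that by (auto simp: nu_def)
  have wip: "wip m nu (\<lambda>p. f (vs ! p)) (\<lambda>p. g (vs ! p)) = (\<Sum>i\<in>V0. mu i * f i * g i)" for f g
    unfolding wip_def nu_def using bij by (rule sum.reindex_bij_betw)
  have qform: "qform m a (\<lambda>p. g (vs ! p)) (\<lambda>p. g (vs ! p)) = 2 * edge_form E0 sg w g" for g
  proof -
    let ?A = "\<lambda>i j. if {i, j} \<in> E0 then sg {i, j} * w {i, j} else 0"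
    have "qform m a (\<lambda>p. g (vs ! p)) (\<lambda>p. g (vs ! p)) =
      (\<Sum>p<m. \<Sum>q<m. ?A (vs ! p) (vs ! q) * g (vs ! p) * g (vs ! q))"
      unfolding qform_def a_def by (intro sum.cong) (simp_all add: sum_distrib_left mult_ac)
    also have "\<dots> = (\<Sum>p<m. \<Sum>j\<in>V0. ?A (vs ! p) j * g (vs ! p) * g j)"
      by (intro sum.cong refl sum.reindex_bij_betw bij)
    also have "\<dots> = (\<Sum>i\<in>V0. \<Sum>j\<in>V0. ?A i j * g i * g j)"
      using sum.reindex_bij_betw[OF bij, of "\<lambda>i. \<Sum>j\<in>V0. ?A i j * g i * g j"] by simp
    also have "\<dots> = 2 * edge_form E0 sg w g"
      unfolding edge_form_def using sum_pairs_eq_sum_edges[OF fin E, where c = "\<lambda>e. sg e * w e"] by simp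
    finally show ?thesis .
  qed
  have adj: "norm_adj V0 E0 sg w mu = mat m m (\<lambda>(p, q). a p q / nu p)"
    unfolding norm_adj_def Let_def m_def vs_def a_def nu_def by (intro cong_mat) auto
  obtain v lam where v:
    "\<And>s t. s < m \<Longrightarrow> t < m \<Longrightarrow> wip m nu (v s) (v t) = (if s = t then 1 else 0)"
    "\<And>k. 1 \<le> k \<Longrightarrow> k \<le> m \<Longrightarrow> eig (mat m m (\<lambda>(i, j). a i j / nu i)) k = lam (k - 1)"
    "\<And>s g. s < m \<Longrightarrow> (\<And>t. t < s \<Longrightarrow> wip m nu (v t) g = 0) \<Longrightarrow> lam s * wip m nu g g \<le> qform m a g g"
    "\<And>s g c. s < m \<Longrightarrow> (\<And>i. i < m \<Longrightarrow> g i = (\<Sum>t\<le>s. c t * v t i)) \<Longrightarrow> qform m a g g \<le> lam s * wip m nu g g"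
  proof (rule spectral_theorem_weighted[of m a nu])
    show "a i j = a j i" for i j by (simp add: a_def insert_commute)
  qed (use nu in blast)+
  define ix where "ix = the_inv_into {..<m} (\<lambda>p. vs ! p)"
  have ix: "ix (vs ! p) = p" if "p < m" for p
    unfolding ix_def using bij that by (intro the_inv_into_f_f) (auto simp: bij_betw_def)
  define u where "u s i = v s (ix i)" for s i
  have uv: "u s (vs ! p) = v s p" if "p < m" for s p by (simp add: u_def ix that)
  have ip: "(\<Sum>i\<in>V0. mu i * u s i * g i) = wip m nu (v s) (\<lambda>p. g (vs ! p))" for s g
    unfolding wip[symmetric] by (rule wip_cong) (simp_all add: uv)
  have norm: "(\<Sum>i\<in>V0. mu i * (g i)\<^sup>2) = wip m nu (\<lambda>p. g (vs ! p)) (\<lambda>p. g (vs ! p))" for g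
    unfolding wip by (simp add: power2_eq_square mult.assoc)
  show thesis
  proof (rule that[of u lam])
    fix s t assume "s < card V0" "t < card V0"
    then have st: "s < m" "t < m" by (simp_all add: m_def)
    have "wip m nu (v s) (\<lambda>p. u t (vs ! p)) = wip m nu (v s) (v t)"
      by (rule wip_cong) (simp_all add: uv)
    then show "(\<Sum>i\<in>V0. mu i * u s i * u t i) = (if s = t then 1 else 0)"
      unfolding ip using v(1)[OF st] by simp
  next
    fix k assume "1 \<le> k" "k \<le> card V0"
    then show "eig (norm_adj V0 E0 sg w mu) k = lam (k - 1)"
      unfolding adj using v(2) by (simp add: m_def)
  next
    fix s g assume "s < card V0" "\<And>t. t < s \<Longrightarrow> (\<Sum>i\<in>V0. mu i * u t i * g i) = 0"
    then show "lam s * (\<Sum>i\<in>V0. mu i * (g i)\<^sup>2) \<le> 2 * edge_form E0 sg w g"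
      unfolding norm qform[symmetric] ip by (intro v(3)) (simp_all add: m_def)
  next
    fix s g c assume s: "s < card V0" and g: "\<And>i. i \<in> V0 \<Longrightarrow> g i = (\<Sum>t\<le>s. c t * u t i)"
    show "2 * edge_form E0 sg w g \<le> lam s * (\<Sum>i\<in>V0. mu i * (g i)\<^sup>2)"
      unfolding norm qform[symmetric]
    proof (rule v(4))
      show "s < m" using s by (simp add: m_def)
      show "g (vs ! p) = (\<Sum>t\<le>s. c t * v t p)" if "p < m" for p
        using g[of "vs ! p"] bij_betwE[OF bij] that by (simp add: uv)
    qed
  qed
qed

lemma signed_graphD:
  assumes "signed_graph n E sg w mu"
  shows "finite E"
    and "\<And>e. e \<in> E \<Longrightarrow> \<exists>i j. e = {i, j} \<and> i \<noteq> j \<and> i < n \<and> j < n"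
    and "\<And>e. e \<in> E \<Longrightarrow> Min e < n" "\<And>e. e \<in> E \<Longrightarrow> Max e < n"
    and "\<And>e. e \<in> E \<Longrightarrow> sg e = 1 \<or> sg e = - 1"
    and "\<And>e. e \<in> E \<Longrightarrow> w e > 0"
    and "\<And>i. i < n \<Longrightarrow> mu i > 0"
proof -
  show E: "\<And>e. e \<in> E \<Longrightarrow> \<exists>i j. e = {i, j} \<and> i \<noteq> j \<and> i < n \<and> j < n"
    and "\<And>e. e \<in> E \<Longrightarrow> sg e = 1 \<or> sg e = - 1" and "\<And>e. e \<in> E \<Longrightarrow> w e > 0" and "\<And>i. i < n \<Longrightarrow> mu i > 0"
    using assms unfolding signed_graph_def by blast+
  have "E \<subseteq> Pow {..<n}" using E by blast
  then show "finite E" by (rule finite_subset) simp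
  show "Min e < n" "Max e < n" if e: "e \<in> E" for e
  proof -
    obtain i j where "e = {i, j}" "i < n" "j < n" using E[OF e] by metis
    then show "Min e < n" "Max e < n" by simp_all
  qed
qed

lemma subgraph_edge:
  assumes G: "signed_graph n E sg w mu" and sub: "(V0, E0) \<in> subgraphs n E" and e: "e \<in> E0"
  shows "\<exists>i j. e = {i, j} \<and> i \<noteq> j \<and> i \<in> V0 \<and> j \<in> V0"
proof -
  have "e \<in> E" "e \<subseteq> V0" using sub e by (auto simp: subgraphs_def)
  then obtain i j where "e = {i, j}" "i \<noteq> j" using signed_graphD(2)[OF G] by metis
  then show ?thesis using \<open>e \<subseteq> V0\<close> by (intro exI[of _ i] exI[of _ j]) simp
qed

text \<open>Dimension count in the span of the first \<open>k\<close> eigenvectors of the spanning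
  subgraph: vanishing off \<open>V0\<close> costs \<open>n - card V0\<close> conditions, and
  orthogonality to the eigenvectors of the smaller graph below the one in question costs
  \<open>card V0 + k - n - 1\<close>, together \<open>k - 1\<close>. A nonzero solution has the same
  norm in both graphs, as it vanishes off \<open>V0\<close>, and the same form, as the edges agree;
  so it compares the two eigenvalues.\<close>

lemma subgraph_interlacing:
  assumes G: "signed_graph n E sg w mu" and sub: "(V0, E0) \<in> subgraphs n E"
    and k: "1 \<le> k" "k \<le> n" and card: "card V0 \<ge> n - k + 1"
  shows "eig (norm_adj V0 E0 sg' w mu) (card V0 + k - n) \<le> eig (norm_adj {..<n} E0 sg' w mu) k"
proof -
  define m where "m = card V0"
  define j where "j = m + k - n"
  have V0: "V0 \<subseteq> {..<n}" using sub by (simp add: subgraphs_def)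
  then have fin: "finite V0" using finite_subset by blast
  have "m \<le> n" using V0 card_mono[of "{..<n}" V0] by (simp add: m_def)
  then have j: "1 \<le> j" "j \<le> m" "j + (n - m) = k" using card k by (auto simp: j_def m_def)
  note muG = signed_graphD(7)[OF G]
  obtain v lam where v:
    "\<And>s. 1 \<le> s \<Longrightarrow> s \<le> card V0 \<Longrightarrow> eig (norm_adj V0 E0 sg' w mu) s = lam (s - 1)"
    "\<And>s g. s < card V0 \<Longrightarrow> (\<And>t. t < s \<Longrightarrow> (\<Sum>i\<in>V0. mu i * v t i * g i) = 0) \<Longrightarrow>
       lam s * (\<Sum>i\<in>V0. mu i * (g i)\<^sup>2) \<le> 2 * edge_form E0 sg' w g"
  proof (rule subgraph_spectral_basis[of V0 E0 mu sg' w])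
    show "\<exists>i j. e = {i, j} \<and> i \<noteq> j \<and> i \<in> V0 \<and> j \<in> V0" if "e \<in> E0" for e
      using subgraph_edge[OF G sub that] .
  qed (use fin muG V0 in auto)
  obtain u nu where u:
    "\<And>s t. s < n \<Longrightarrow> t < n \<Longrightarrow> (\<Sum>i<n. mu i * u s i * u t i) = (if s = t then 1 else 0)"
    "\<And>s. 1 \<le> s \<Longrightarrow> s \<le> n \<Longrightarrow> eig (norm_adj {..<n} E0 sg' w mu) s = nu (s - 1)"
    "\<And>s g c. s < n \<Longrightarrow> (\<And>i. i < n \<Longrightarrow> g i = (\<Sum>t\<le>s. c t * u t i)) \<Longrightarrow>
       2 * edge_form E0 sg' w g \<le> nu s * (\<Sum>i<n. mu i * (g i)\<^sup>2)"
  proof (rule subgraph_spectral_basis[of "{..<n}" E0 mu sg' w])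
    show "\<exists>i j. e = {i, j} \<and> i \<noteq> j \<and> i \<in> {..<n} \<and> j \<in> {..<n}" if "e \<in> E0" for e
      using subgraph_edge[OF G sub that] V0 by blast
  qed (use muG in auto)
  \<comment> \<open>\<open>Inl\<close> labels the orthogonality conditions, \<open>Inr\<close> the
    vertices at which \<open>g\<close> has to vanish.\<close>
  let ?R = "Inl ` {..<j - 1} \<union> Inr ` ({..<n} - V0)"
  define A :: "nat + nat \<Rightarrow> nat \<Rightarrow> real" where
    "A r t = (case r of Inl s \<Rightarrow> \<Sum>i\<in>V0. mu i * v s i * u t i | Inr i \<Rightarrow> u t i)" for r t
  have "card ?R = (j - 1) + (n - m)"
    using V0 by (subst card_Un_disjoint) (auto simp: card_image m_def card_Diff_subset fin)
  then have "card ?R < card {..<k}" using j by simp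
  then obtain c where c: "\<exists>t\<in>{..<k}. c t \<noteq> 0" "\<forall>r\<in>?R. (\<Sum>t\<in>{..<k}. A r t * c t) = 0"
    using homogeneous_system_nontrivial[of ?R "{..<k}" A] by auto
  define g where "g i = (\<Sum>t<k. c t * u t i)" for i
  have kk: "{..<k} = {..k - 1}" using k by auto
  have g0: "g i = 0" if "i < n" "i \<notin> V0" for i
  proof -
    have "(\<Sum>t\<in>{..<k}. A (Inr i) t * c t) = 0" using c(2) that by blast
    then show ?thesis by (simp add: g_def A_def mult.commute)
  qed
  have gv: "(\<Sum>i\<in>V0. mu i * v s i * g i) = 0" if "s < j - 1" for s
  proof -
    have "Inl s \<in> ?R" using that by simp
    with c(2) have "0 = (\<Sum>t\<in>{..<k}. A (Inl s) t * c t)" by simp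
    also have "\<dots> = (\<Sum>t\<in>{..<k}. \<Sum>i\<in>V0. mu i * v s i * (c t * u t i))"
      by (simp add: A_def sum_distrib_left sum_distrib_right mult_ac)
    also have "\<dots> = (\<Sum>i\<in>V0. \<Sum>t\<in>{..<k}. mu i * v s i * (c t * u t i))" by (rule sum.swap)
    also have "\<dots> = (\<Sum>i\<in>V0. mu i * v s i * g i)" by (simp add: g_def sum_distrib_left)
    finally show ?thesis by simp
  qed
  have norm: "(\<Sum>i\<in>V0. mu i * (g i)\<^sup>2) = (\<Sum>i<n. mu i * (g i)\<^sup>2)"
    using V0 g0 by (intro sum.mono_neutral_left) auto
  have pos: "(\<Sum>i<n. mu i * (g i)\<^sup>2) > 0"
  proof -
    obtain t where t: "t < k" "c t \<noteq> 0" using c(1) by auto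
    \<comment> \<open>Pairing with \<open>u t\<close> recovers the nonzero coefficient
      \<open>c t\<close>, so \<open>g\<close> does not vanish identically.\<close>
    have "(\<Sum>i<n. mu i * u t i * g i) = (\<Sum>i<n. \<Sum>s<k. c s * (mu i * u t i * u s i))"
      by (simp add: g_def sum_distrib_left mult_ac)
    also have "\<dots> = (\<Sum>s<k. \<Sum>i<n. c s * (mu i * u t i * u s i))" by (rule sum.swap)
    also have "\<dots> = (\<Sum>s<k. if t = s then c s else 0)"
      using u(1)[of t] t k by (intro sum.cong) (auto simp flip: sum_distrib_left)
    also have "\<dots> = c t" using t by simp
    finally have "(\<Sum>i<n. mu i * u t i * g i) \<noteq> 0" using t by simp
    then obtain i where i: "i < n" "g i \<noteq> 0" by (auto elim: sum.not_neutral_contains_not_neutral)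
    have "0 \<le> mu l * (g l)\<^sup>2" if "l < n" for l using muG[OF that] by simp
    moreover have "0 < mu i * (g i)\<^sup>2" using muG[OF i(1)] i(2) by simp
    ultimately show ?thesis using i(1) by (intro sum_pos2[of _ i]) auto
  qed
  have "lam (j - 1) * (\<Sum>i<n. mu i * (g i)\<^sup>2) \<le> 2 * edge_form E0 sg' w g"
    unfolding norm[symmetric] using j gv by (intro v(2)) (auto simp: m_def)
  also have "\<dots> \<le> nu (k - 1) * (\<Sum>i<n. mu i * (g i)\<^sup>2)"
    using k by (intro u(3)[where c = c]) (auto simp: g_def kk)
  finally have "lam (j - 1) \<le> nu (k - 1)" using pos by (rule mult_right_le_imp_le)
  then show ?thesis using v(1)[of j] u(2)[of k] j k by (simp add: j_def m_def)
qed

section \<open>The cut-off form and its bounds\<close>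

definition cutoff_form :: "nat set set \<Rightarrow> (nat set \<Rightarrow> real) \<Rightarrow> (nat set \<Rightarrow> real) \<Rightarrow> (nat \<Rightarrow> real) \<Rightarrow> real" where
  "cutoff_form E sg w h = (\<Sum>e\<in>E. w e * max 0 (- sg e * h (Min e) * h (Max e)))"

lemma edge_form_le_cutoff_form:
  assumes G: "signed_graph n E sg w mu" and "E0 \<subseteq> E"
  shows "edge_form E0 (\<lambda>e. - sg e) w h \<le> cutoff_form E sg w h"
proof -
  note gD = signed_graphD[OF G]
  have "edge_form E0 (\<lambda>e. - sg e) w h = (\<Sum>e\<in>E0. w e * (- sg e * h (Min e) * h (Max e)))"
    unfolding edge_form_def by (intro sum.cong) auto
  also have "\<dots> \<le> (\<Sum>e\<in>E0. w e * max 0 (- sg e * h (Min e) * h (Max e)))"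
    using gD(6) assms(2) by (intro sum_mono mult_left_mono) (auto intro: less_imp_le)
  also have "\<dots> \<le> cutoff_form E sg w h"
    unfolding cutoff_form_def using gD(1,6) assms(2) by (intro sum_mono2) (auto intro!: mult_nonneg_nonneg intro: less_imp_le)
  finally show ?thesis .
qed

text \<open>The sum stands in for the maximum of the \<open>1 / mu i\<close>, as one bound for all
  coordinates.\<close>

lemma coordinate_bound_sphere:
  assumes mu: "\<And>i. i < n \<Longrightarrow> mu i > 0" and h: "h \<in> sphere_p n mu 2" and i: "i < n"
  shows "(h i)\<^sup>2 \<le> (\<Sum>i<n. 1 / mu i)"
proof -
  have "mu i * (h i)\<^sup>2 \<le> (\<Sum>i<n. mu i * (h i)\<^sup>2)"
    using mu i by (intro member_le_sum) (auto intro!: mult_nonneg_nonneg intro: less_imp_le)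
  then have "(h i)\<^sup>2 \<le> 1 / mu i" using h mu[OF i] by (simp add: sphere_p_2 field_simps)
  also have "\<dots> \<le> (\<Sum>i<n. 1 / mu i)"
    using mu i by (intro member_le_sum) (auto intro: less_imp_le)
  finally show ?thesis .
qed

lemma cutoff_form_bounds:
  assumes G: "signed_graph n E sg w mu" and h: "h \<in> sphere_p n mu 2"
  shows "0 \<le> cutoff_form E sg w h" "cutoff_form E sg w h \<le> (\<Sum>e\<in>E. w e) * (\<Sum>i<n. 1 / mu i)"
proof -
  note gD = signed_graphD[OF G]
  let ?M = "\<Sum>i<n. 1 / mu i"
  show "0 \<le> cutoff_form E sg w h"
    unfolding cutoff_form_def using gD(6) by (intro sum_nonneg mult_nonneg_nonneg) (auto intro: less_imp_le)
  have "w e * max 0 (- sg e * h (Min e) * h (Max e)) \<le> w e * ?M" if e: "e \<in> E" for e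
  proof (rule mult_left_mono)
    have b: "(h (Min e))\<^sup>2 \<le> ?M" "(h (Max e))\<^sup>2 \<le> ?M"
      using coordinate_bound_sphere[OF gD(7) h] gD(3,4) e by auto
    have "- sg e * h (Min e) * h (Max e) \<le> \<bar>h (Min e)\<bar> * \<bar>h (Max e)\<bar>"
      using gD(5)[OF e] by (auto simp flip: abs_mult)
    also have "\<dots> \<le> ?M"
      using b sum_squares_bound[of "\<bar>h (Min e)\<bar>" "\<bar>h (Max e)\<bar>"] by simp
    finally show "max 0 (- sg e * h (Min e) * h (Max e)) \<le> ?M"
      using b(1) by (meson max.boundedI order_trans zero_le_power2)
  qed (use gD(6) e less_imp_le in blast)
  then show "cutoff_form E sg w h \<le> (\<Sum>e\<in>E. w e) * ?M"
    unfolding cutoff_form_def sum_distrib_right by (rule sum_mono)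
qed

section \<open>Cut-off eigenvalues\<close>

text \<open>The denominator is 1 after the substitution, so the edges and the potential can be
  estimated term by term, uniformly in \<open>h\<close>. The potential enters only through the
  error, which is why the limit does not depend on it.\<close>

lemma rescaled_rayleigh_estimate:
  assumes G: "signed_graph n E sg w mu" and h: "h \<in> sphere_p n mu 2" and p: "p > 2"
  shows "\<bar>2 powr (- p) * rayleigh_p n E sg w mu kappa p (\<lambda>i. spow (2 / p) (h i)) - cutoff_form E sg w h\<bar>
    \<le> (2 powr (- p) + (p / 2) / (p / 2 - 1)\<^sup>2) *
       (((\<Sum>e\<in>E. w e) + (\<Sum>i<n. \<bar>kappa i\<bar>)) * (\<Sum>i<n. 1 / mu i))"
proof -
  note gD = signed_graphD[OF G]
  define f where "f i = spow (2 / p) (h i)" for i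
  define d where "d = 2 powr (- p) + (p / 2) / (p / 2 - 1)\<^sup>2"
  define M where "M = (\<Sum>i<n. 1 / mu i)"
  have d: "2 powr (- p) \<le> d" "0 \<le> d" using p by (auto simp: d_def)
  have b: "(h i)\<^sup>2 \<le> M" if "i < n" for i
    unfolding M_def using gD(7) h that by (rule coordinate_bound_sphere)
  have fp: "\<bar>f i\<bar> powr p = (h i)\<^sup>2" for i
    using p by (simp add: f_def abs_spow powr_powr)
  have den: "(\<Sum>i<n. mu i * \<bar>f i\<bar> powr p) = 1" using h by (simp add: fp sphere_p_2)
  define N where "N e = 2 powr (- p) * \<bar>f (Min e) - sg e * f (Max e)\<bar> powr p" for e
  define C where "C e = max 0 (- sg e * h (Min e) * h (Max e))" for e
  have edge: "\<bar>N e - C e\<bar> \<le> d * M" if e: "e \<in> E" for e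
  proof -
    have sg: "sg e = 1 \<or> sg e = - 1" using gD(5) e .
    \<comment> \<open>The edge sign moves into the second argument, since the signed power is odd;
      this gives the sum treated by \<open>cutoff_edge_estimate\<close>.\<close>
    have "f (Min e) - sg e * f (Max e) = spow (2 / p) (h (Min e)) + spow (2 / p) (- sg e * h (Max e))"
      using sg by (auto simp: f_def spow_uminus)
    moreover have "- sg e * h (Min e) * h (Max e) = h (Min e) * (- sg e * h (Max e))" by simp
    ultimately have "\<bar>N e - C e\<bar> \<le> d * max ((h (Min e))\<^sup>2) ((- sg e * h (Max e))\<^sup>2)"
      unfolding N_def C_def d_def using cutoff_edge_estimate[OF p] by (simp only:)
    also have "(- sg e * h (Max e))\<^sup>2 = (h (Max e))\<^sup>2" using sg by auto
    also have "d * max ((h (Min e))\<^sup>2) ((h (Max e))\<^sup>2) \<le> d * M"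
      using b gD(3,4) e d by (intro mult_left_mono) auto
    finally show ?thesis .
  qed
  have "2 powr (- p) * rayleigh_p n E sg w mu kappa p f - cutoff_form E sg w h =
      (\<Sum>e\<in>E. w e * (N e - C e)) + (\<Sum>i<n. 2 powr (- p) * (kappa i * (h i)\<^sup>2))"
    unfolding rayleigh_p_def den unfolding fp cutoff_form_def N_def C_def
    by (simp add: distrib_left right_diff_distrib sum_subtractf sum_distrib_left mult_ac)
  also have "\<bar>\<dots>\<bar> \<le> (\<Sum>e\<in>E. \<bar>w e * (N e - C e)\<bar>) + (\<Sum>i<n. \<bar>2 powr (- p) * (kappa i * (h i)\<^sup>2)\<bar>)"
    by (intro order_trans[OF abs_triangle_ineq] add_mono sum_abs)
  also have "\<dots> \<le> (\<Sum>e\<in>E. w e * (d * M)) + (\<Sum>i<n. d * (\<bar>kappa i\<bar> * M))"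
  proof (intro add_mono sum_mono)
    fix e assume e: "e \<in> E"
    show "\<bar>w e * (N e - C e)\<bar> \<le> w e * (d * M)"
      using edge[OF e] gD(6)[OF e] by (simp add: abs_mult)
  next
    fix i assume "i \<in> {..<n}"
    then have "\<bar>kappa i\<bar> * (h i)\<^sup>2 \<le> \<bar>kappa i\<bar> * M" using b by (intro mult_left_mono) auto
    then have "2 powr (- p) * (\<bar>kappa i\<bar> * (h i)\<^sup>2) \<le> d * (\<bar>kappa i\<bar> * M)"
      using d by (intro mult_mono[of _ d "\<bar>kappa i\<bar> * (h i)\<^sup>2"]) simp_all
    then show "\<bar>2 powr (- p) * (kappa i * (h i)\<^sup>2)\<bar> \<le> d * (\<bar>kappa i\<bar> * M)"
      by (simp add: abs_mult)
  qed
  also have "\<dots> = d * (((\<Sum>e\<in>E. w e) + (\<Sum>i<n. \<bar>kappa i\<bar>)) * M)"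
    by (simp add: sum_distrib_left sum_distrib_right algebra_simps)
  finally show ?thesis unfolding f_def d_def M_def .
qed

definition limit_eigenvalue :: "nat \<Rightarrow> nat set set \<Rightarrow> (nat set \<Rightarrow> real) \<Rightarrow> (nat set \<Rightarrow> real)
    \<Rightarrow> (nat \<Rightarrow> real) \<Rightarrow> nat \<Rightarrow> real" where
  "limit_eigenvalue n E sg w mu k = (INF B\<in>genus_family n mu 2 k. SUP h\<in>B. cutoff_form E sg w h)"

lemma genus_family_nonempty:
  assumes "signed_graph n E sg w mu" "k \<le> n" shows "genus_family n mu 2 k \<noteq> {}"
  using sphere_in_genus_family[of n mu k] signed_graphD(7)[OF assms(1)] assms(2) by blast

lemma genus_familyD:
  assumes "B \<in> genus_family n mu p k"
  shows "B \<subseteq> sphere_p n mu p" "genus B \<ge> k" "k \<ge> 1 \<Longrightarrow> B \<noteq> {}"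
proof -
  show "B \<subseteq> sphere_p n mu p" and g: "genus B \<ge> k" using assms by (simp_all add: genus_family_def)
  show "B \<noteq> {}" if "k \<ge> 1" using genus_pos_nonempty[of B] g that by simp
qed

text \<open>Convergence is shown together with the value: the uniform estimate passes through the
  min-max in both directions and leaves the error \<open>d p * C\<close>, where \<open>d p\<close>
  is of order \<open>1 / p\<close>.\<close>

lemma cutoff_eigenvalue_eq_limit_eigenvalue:
  assumes G: "signed_graph n E sg w mu" and k: "1 \<le> k" "k \<le> n"
  shows "cutoff_eigenvalue n E sg w mu kappa k = limit_eigenvalue n E sg w mu k"
proof -
  define C where "C = ((\<Sum>e\<in>E. w e) + (\<Sum>i<n. \<bar>kappa i\<bar>)) * (\<Sum>i<n. 1 / mu i)"
  define d where "d p = 2 powr (- p) + (p / 2) / (p / 2 - 1)\<^sup>2" for p :: real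
  define K where "K = (\<Sum>e\<in>E. w e) * (\<Sum>i<n. 1 / mu i)"
  let ?S = "sphere_p n mu 2"
  have ne: "genus_family n mu 2 k \<noteq> {}" using genus_family_nonempty[OF G k(2)] .
  have bK: "\<bar>cutoff_form E sg w h\<bar> \<le> K" if "h \<in> ?S" for h
    using cutoff_form_bounds[OF G that] by (simp add: K_def)
  have close: "\<bar>2 powr (- p) * p_eigenvalue n E sg w mu kappa p k - limit_eigenvalue n E sg w mu k\<bar> \<le> d p * C"
    if p: "p > 2" for p
  proof -
    define R where "R h = rayleigh_p n E sg w mu kappa p (\<lambda>i. spow (2 / p) (h i))" for h
    have P: "p_eigenvalue n E sg w mu kappa p k = (INF B\<in>genus_family n mu 2 k. SUP h\<in>B. R h)"
      unfolding p_eigenvalue_def R_def using p by (intro INF_SUP_genus_family_spow) auto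
    have est: "\<bar>2 powr (- p) * R h - cutoff_form E sg w h\<bar> \<le> d p * C" if "h \<in> ?S" for h
      unfolding R_def d_def C_def using G that p by (rule rescaled_rayleigh_estimate)
    have inv: "2 powr p * (2 powr (- p) * x) = x" and inv': "2 powr (- p) * (2 powr p * x) = x" for x :: real
      by (simp_all add: powr_minus)
    have R_le: "R h \<le> 2 powr p * cutoff_form E sg w h + 2 powr p * (d p * C)" if "h \<in> ?S" for h
    proof -
      have "2 powr (- p) * R h \<le> cutoff_form E sg w h + d p * C" using est[OF that] by linarith
      then have "2 powr p * (2 powr (- p) * R h) \<le> 2 powr p * (cutoff_form E sg w h + d p * C)"
        by (rule mult_left_mono) simp
      then show ?thesis unfolding inv by (simp add: distrib_left)
    qed
    have le_R: "cutoff_form E sg w h \<le> 2 powr (- p) * R h + d p * C" if "h \<in> ?S" for h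
      using est[OF that] by linarith
    have bR: "\<bar>R h\<bar> \<le> 2 powr p * (K + d p * C)" if "h \<in> ?S" for h
    proof -
      have "\<bar>2 powr (- p) * R h\<bar> \<le> K + d p * C" using est[OF that] bK[OF that] by linarith
      then have le: "2 powr p * \<bar>2 powr (- p) * R h\<bar> \<le> 2 powr p * (K + d p * C)"
        by (rule mult_left_mono) simp
      have "2 powr p * \<bar>2 powr (- p) * R h\<bar> = \<bar>2 powr p * (2 powr (- p) * R h)\<bar>"
        by (simp only: abs_mult abs_of_nonneg[OF powr_ge_zero])
      then show ?thesis using le by (simp only: inv)
    qed
    have "p_eigenvalue n E sg w mu kappa p k \<le> 2 powr p * limit_eigenvalue n E sg w mu k + 2 powr p * (d p * C)"
      unfolding P limit_eigenvalue_def
      proof (rule INF_SUP_le_affine[where S = ?S])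
      show "B \<noteq> {}" "B \<subseteq> ?S" if "B \<in> genus_family n mu 2 k" for B
        using genus_familyD[OF that] k(1) by auto
    qed (fact ne bR bK R_le | simp)+
    then have "2 powr (- p) * p_eigenvalue n E sg w mu kappa p k \<le>
        2 powr (- p) * (2 powr p * limit_eigenvalue n E sg w mu k + 2 powr p * (d p * C))"
      by (rule mult_left_mono) simp
    also have "\<dots> = limit_eigenvalue n E sg w mu k + d p * C"
      by (simp only: distrib_left inv')
    finally have 1: "2 powr (- p) * p_eigenvalue n E sg w mu kappa p k \<le> limit_eigenvalue n E sg w mu k + d p * C" .
    have 2: "limit_eigenvalue n E sg w mu k \<le> 2 powr (- p) * p_eigenvalue n E sg w mu kappa p k + d p * C"
      unfolding P limit_eigenvalue_def
      proof (rule INF_SUP_le_affine[where S = ?S])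
      show "B \<noteq> {}" "B \<subseteq> ?S" if "B \<in> genus_family n mu 2 k" for B
        using genus_familyD[OF that] k(1) by auto
    qed (fact ne bR bK le_R | simp)+
    show ?thesis using 1 2 by linarith
  qed
  have "(d \<longlongrightarrow> 0) at_top" unfolding d_def by real_asymp
  then have "((\<lambda>p. d p * C) \<longlongrightarrow> 0) at_top" by (rule tendsto_mult_left_zero)
  moreover have "\<forall>\<^sub>F p in at_top. norm (2 powr (- p) * p_eigenvalue n E sg w mu kappa p k - limit_eigenvalue n E sg w mu k) \<le> d p * C"
    using eventually_gt_at_top[of 2] by eventually_elim (use close in simp)
  ultimately have "((\<lambda>p. 2 powr (- p) * p_eigenvalue n E sg w mu kappa p k - limit_eigenvalue n E sg w mu k) \<longlongrightarrow> 0) at_top"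
    by (rule Lim_null_comparison[rotated])
  then have "((\<lambda>p. 2 powr (- p) * p_eigenvalue n E sg w mu kappa p k) \<longlongrightarrow> limit_eigenvalue n E sg w mu k) at_top"
    by (rule LIM_zero_cancel)
  then show ?thesis unfolding cutoff_eigenvalue_def by (intro tendsto_Lim) auto
qed

lemma bdd_above_cutoff_form:
  assumes "signed_graph n E sg w mu" "B \<subseteq> sphere_p n mu 2"
  shows "bdd_above (cutoff_form E sg w ` B)"
  using cutoff_form_bounds(2)[OF assms(1)] assms(2) by (meson bdd_above.I2 subsetD)

lemma spanning_subgraph_edge:
  assumes G: "signed_graph n E sg w mu" and "E0 \<subseteq> E" "e \<in> E0"
  shows "\<exists>i j. e = {i, j} \<and> i \<noteq> j \<and> i \<in> {..<n} \<and> j \<in> {..<n}"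
  using signed_graphD(2)[OF G, of e] assms(2,3) by auto

lemma half_eig_le_limit_eigenvalue:
  assumes G: "signed_graph n E sg w mu" and k: "1 \<le> k" "k \<le> n" and E0: "E0 \<subseteq> E"
  shows "1/2 * eig (norm_adj {..<n} E0 (\<lambda>e. - sg e) w mu) k \<le> limit_eigenvalue n E sg w mu k"
proof -
  obtain v lam where v:
    "\<And>s. 1 \<le> s \<Longrightarrow> s \<le> card {..<n} \<Longrightarrow> eig (norm_adj {..<n} E0 (\<lambda>e. - sg e) w mu) s = lam (s - 1)"
    "\<And>s g. s < card {..<n} \<Longrightarrow> (\<And>t. t < s \<Longrightarrow> (\<Sum>i\<in>{..<n}. mu i * v t i * g i) = 0) \<Longrightarrow>
       lam s * (\<Sum>i\<in>{..<n}. mu i * (g i)\<^sup>2) \<le> 2 * edge_form E0 (\<lambda>e. - sg e) w g"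
    by (rule subgraph_spectral_basis[of "{..<n}" E0 mu "\<lambda>e. - sg e" w])
      (use signed_graphD(7)[OF G] spanning_subgraph_edge[OF G E0] in auto)
  show ?thesis
    unfolding limit_eigenvalue_def
  proof (rule cINF_greatest[OF genus_family_nonempty[OF G k(2)]])
    fix B assume B: "B \<in> genus_family n mu 2 k"
    note BD = genus_familyD[OF B]
    \<comment> \<open>The pairings with the \<open>k - 1\<close> lowest eigenvectors are odd
      functionals, one fewer than the bound \<open>k\<close> on the genus.\<close>
    obtain f where f: "f \<in> B" "\<And>t. t < k - 1 \<Longrightarrow> (\<Sum>i<n. mu i * v t i * f i) = 0"
    proof (rule genus_common_zero[of "k - 1" B "\<lambda>t f. \<Sum>i<n. mu i * v t i * f i"])
      show "k - 1 < genus B" using BD(2) k by linarith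
      show "continuous_on B (\<lambda>f. \<Sum>i<n. mu i * v t i * f i)" for t
        by (intro continuous_intros continuous_on_subset[OF continuous_on_product_coordinates]) simp
    qed (simp_all add: sum_negf)
    have "(\<Sum>i<n. mu i * (f i)\<^sup>2) = 1" using f(1) BD(1) by (auto simp: sphere_p_2)
    then have "lam (k - 1) \<le> 2 * edge_form E0 (\<lambda>e. - sg e) w f"
      using v(2)[of "k - 1" f] f(2) k by simp
    also have "\<dots> \<le> 2 * cutoff_form E sg w f"
      using edge_form_le_cutoff_form[OF G E0] by simp
    also have "\<dots> \<le> 2 * (SUP h\<in>B. cutoff_form E sg w h)"
      using cSUP_upper[OF f(1) bdd_above_cutoff_form[OF G BD(1)]] by simp
    finally show "1/2 * eig (norm_adj {..<n} E0 (\<lambda>e. - sg e) w mu) k \<le> (SUP h\<in>B. cutoff_form E sg w h)"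
      using v(1)[of k] k by simp
  qed
qed

lemma cutoff_form_le_antibalanced_eig:
  assumes G: "signed_graph n E sg w mu" and n: "1 \<le> n" and h: "h \<in> sphere_p n mu 2"
  obtains E0 where "E0 \<subseteq> E" "antibalanced {..<n} E0 sg"
    "cutoff_form E sg w h \<le> 1/2 * eig (norm_adj {..<n} E0 (\<lambda>e. - sg e) w mu) n"
proof -
  note gD = signed_graphD[OF G]
  define E0 where "E0 = {e \<in> E. 0 < - sg e * h (Min e) * h (Max e)}"
  have E0: "E0 \<subseteq> E" by (auto simp: E0_def)
  have "antibalanced {..<n} E0 sg"
    unfolding antibalanced_def
  \<comment> \<open>Edges of \<open>E0\<close> have nonzero values of \<open>h\<close> at both ends,
    so the sign assigned to a zero of \<open>h\<close> is immaterial.\<close>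
  proof (intro exI[of _ "\<lambda>i. if h i \<ge> 0 then 1 else - 1"] conjI ballI)
    fix e assume e: "e \<in> E0"
    then have "sg e = 1 \<or> sg e = - 1" using gD(5) E0 by blast
    then show "(if h (Min e) \<ge> 0 then 1 else - 1) * sg e * (if h (Max e) \<ge> 0 then 1 else - 1) = - 1"
      using e by (auto simp: E0_def zero_less_mult_iff mult_less_0_iff not_le)
  qed auto
  moreover have "cutoff_form E sg w h \<le> 1/2 * eig (norm_adj {..<n} E0 (\<lambda>e. - sg e) w mu) n"
  proof -
    obtain v lam where v:
      "\<And>s t. s < card {..<n} \<Longrightarrow> t < card {..<n} \<Longrightarrow> (\<Sum>i\<in>{..<n}. mu i * v s i * v t i) = (if s = t then 1 else 0)"
      "\<And>s. 1 \<le> s \<Longrightarrow> s \<le> card {..<n} \<Longrightarrow> eig (norm_adj {..<n} E0 (\<lambda>e. - sg e) w mu) s = lam (s - 1)"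
      "\<And>s g c. s < card {..<n} \<Longrightarrow> (\<And>i. i \<in> {..<n} \<Longrightarrow> g i = (\<Sum>t\<le>s. c t * v t i)) \<Longrightarrow>
        2 * edge_form E0 (\<lambda>e. - sg e) w g \<le> lam s * (\<Sum>i\<in>{..<n}. mu i * (g i)\<^sup>2)"
      by (rule subgraph_spectral_basis[of "{..<n}" E0 mu "\<lambda>e. - sg e" w])
        (use gD(7) spanning_subgraph_edge[OF G E0] in auto)
    \<comment> \<open>With \<open>s = n - 1\<close> the span in \<open>v(3)\<close> is the whole
      space, so the top eigenvalue bounds the form at every \<open>h\<close>.\<close>
    have "h i = (\<Sum>t\<le>n - 1. wip n mu (v t) h * v t i)" if "i < n" for i
    proof -
      have "{..n - 1} = {..<n}" using n by auto
      then show ?thesis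
        using orthonormal_completeness[of n mu v i h] v(1) that by (simp add: wip_def)
    qed
    then have "2 * edge_form E0 (\<lambda>e. - sg e) w h \<le> lam (n - 1) * (\<Sum>i<n. mu i * (h i)\<^sup>2)"
      using n by (intro v(3)[where c = "\<lambda>t. wip n mu (v t) h"]) auto
    moreover have "(\<Sum>i<n. mu i * (h i)\<^sup>2) = 1" using h by (simp add: sphere_p_2)
    moreover have "cutoff_form E sg w h = edge_form E0 (\<lambda>e. - sg e) w h"
    proof -
      have "cutoff_form E sg w h = (\<Sum>e\<in>E0. w e * max 0 (- sg e * h (Min e) * h (Max e)))"
        unfolding cutoff_form_def
      proof (intro sum.mono_neutral_right ballI)
        fix e assume "e \<in> E - E0"
        then have "max 0 (- sg e * h (Min e) * h (Max e)) = 0"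
          by (intro max_absorb1) (auto simp: E0_def not_less)
        then show "w e * max 0 (- sg e * h (Min e) * h (Max e)) = 0" by (simp only: mult_zero_right)
      qed (use gD(1) E0 in auto)
      also have "\<dots> = edge_form E0 (\<lambda>e. - sg e) w h"
        unfolding edge_form_def by (intro sum.cong) (auto simp: E0_def max_def)
      finally show ?thesis .
    qed
    ultimately show ?thesis using v(2)[of n] n by simp
  qed
  ultimately show ?thesis using that E0 by blast
qed

theorem theorem5p1:
  fixes n k :: nat and E :: "nat set set" and sg w :: "nat set \<Rightarrow> real"
    and mu kappa :: "nat \<Rightarrow> real"
  assumes G: "signed_graph n E sg w mu"
    and k: "1 \<le> k" "k \<le> n"
  shows
    "cutoff_eigenvalue n E sg w mu kappa k \<ge>
       1/2 * Max ((\<lambda>(V0, E0). eig (norm_adj V0 E0 (\<lambda>e. - sg e) w mu) (card V0 + k - n))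
                 ` {(V0, E0) \<in> subgraphs n E. card V0 \<ge> n - k + 1})
   \<and> Max ((\<lambda>(V0, E0). eig (norm_adj V0 E0 (\<lambda>e. - sg e) w mu) (card V0 + k - n))
                 ` {(V0, E0) \<in> subgraphs n E. card V0 \<ge> n - k + 1})
     = Max ((\<lambda>(V0, E0). eig (norm_adj V0 E0 (\<lambda>e. - sg e) w mu) k)
                 ` {(V0, E0) \<in> subgraphs n E. card V0 = n})
   \<and> cutoff_eigenvalue n E sg w mu kappa n =
       1/2 * Max ((\<lambda>(V0, E0). eig (norm_adj V0 E0 (\<lambda>e. - sg e) w mu) n)
                 ` {(V0, E0) \<in> subgraphs n E. card V0 = n})
   \<and> cutoff_eigenvalue n E sg w mu kappa n =
       1/2 * Max ((\<lambda>(V0, E0). eig (norm_adj V0 E0 (\<lambda>e. - sg e) w mu) n)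
                 ` {(V0, E0) \<in> subgraphs n E. card V0 = n \<and> antibalanced V0 E0 sg})"
proof -
  define ev where "ev V0 E0 = eig (norm_adj V0 E0 (\<lambda>e. - sg e) w mu)" for V0 E0
  define big where "big = {(V0, E0) \<in> subgraphs n E. card V0 \<ge> n - k + 1}"
  define span where "span = {(V0, E0) \<in> subgraphs n E. card V0 = n}"
  define anti where "anti = {(V0, E0) \<in> subgraphs n E. card V0 = n \<and> antibalanced V0 E0 sg}"
  have n: "1 \<le> n" using k by simp
  have "subgraphs n E \<subseteq> Pow {..<n} \<times> Pow E" by (auto simp: subgraphs_def)
  then have finS: "finite (subgraphs n E)"
    using signed_graphD(1)[OF G] by (auto intro: finite_subset)
  have "big \<subseteq> subgraphs n E" "span \<subseteq> subgraphs n E" "anti \<subseteq> subgraphs n E"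
    by (auto simp: big_def span_def anti_def)
  then have fin: "finite big" "finite span" "finite anti"
    using finS by (blast intro: finite_subset)+
  have spanD: "V0 = {..<n}" "E0 \<subseteq> E" if "(V0, E0) \<in> span" for V0 E0
    using that card_subset_eq[of "{..<n}" V0] by (auto simp: span_def subgraphs_def)
  have spanI: "({..<n}, E0) \<in> span" if "E0 \<subseteq> E" for E0
    using that signed_graphD(2)[OF G] by (auto simp: span_def subgraphs_def)
  \<comment> \<open>The edgeless spanning subgraph makes the maximum over antibalanced subgraphs
    range over a nonempty set.\<close>
  have "antibalanced {..<n} {} sg" by (auto simp: antibalanced_def intro!: exI[of _ "\<lambda>_. 1"])
  then have anti0: "({..<n}, {}) \<in> anti" using spanI[of "{}"] by (auto simp: anti_def span_def)
  have anti_span: "anti \<subseteq> span" by (auto simp: anti_def span_def)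
  have span_big: "span \<subseteq> big" using k by (auto simp: big_def span_def)
  have L: "cutoff_eigenvalue n E sg w mu kappa j = limit_eigenvalue n E sg w mu j" if "1 \<le> j" "j \<le> n" for j
    using G that by (rule cutoff_eigenvalue_eq_limit_eigenvalue)
  let ?Mspan = "\<lambda>j. Max ((\<lambda>(V0, E0). ev V0 E0 j) ` span)"
  let ?Mbig = "Max ((\<lambda>(V0, E0). ev V0 E0 (card V0 + k - n)) ` big)"
  let ?Manti = "Max ((\<lambda>(V0, E0). ev V0 E0 n) ` anti)"
  have span_ne: "span \<noteq> {}" using spanI by blast
  have lower: "1/2 * ?Mspan j \<le> cutoff_eigenvalue n E sg w mu kappa j" if j: "1 \<le> j" "j \<le> n" for j
  proof -
    have "?Mspan j \<le> 2 * cutoff_eigenvalue n E sg w mu kappa j"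
    proof (rule Max.boundedI)
      fix x assume "x \<in> (\<lambda>(V0, E0). ev V0 E0 j) ` span"
      then obtain V0 E0 where x: "x = ev V0 E0 j" "(V0, E0) \<in> span" by auto
      show "x \<le> 2 * cutoff_eigenvalue n E sg w mu kappa j"
        using half_eig_le_limit_eigenvalue[OF G j spanD(2)[OF x(2)]] spanD(1)[OF x(2)]
        by (simp add: x(1) ev_def L[OF j])
    qed (use fin span_ne in auto)
    then show ?thesis by simp
  qed
  have eq: "?Mbig = ?Mspan k"
  proof (rule antisym)
    show "?Mbig \<le> ?Mspan k"
    proof (rule Max.boundedI)
      fix x assume "x \<in> (\<lambda>(V0, E0). ev V0 E0 (card V0 + k - n)) ` big"
      then obtain V0 E0 where x: "x = ev V0 E0 (card V0 + k - n)" "(V0, E0) \<in> subgraphs n E" "card V0 \<ge> n - k + 1"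
        by (auto simp: big_def)
      have "E0 \<subseteq> E" using x(2) by (simp add: subgraphs_def)
      have "x \<le> ev {..<n} E0 k"
        unfolding x(1) ev_def by (rule subgraph_interlacing[OF G x(2) k x(3)])
      also have "\<dots> \<le> ?Mspan k"
        using spanI[OF \<open>E0 \<subseteq> E\<close>] fin by (intro Max_ge) force+
      finally show "x \<le> ?Mspan k" .
    qed (use fin span_ne span_big in auto)
    show "?Mspan k \<le> ?Mbig"
    proof (rule Max_mono)
      show "(\<lambda>(V0, E0). ev V0 E0 k) ` span \<subseteq> (\<lambda>(V0, E0). ev V0 E0 (card V0 + k - n)) ` big"
      proof (rule image_subsetI)
        fix x assume x: "x \<in> span"
        then have "card (fst x) = n" by (auto simp: span_def)
        then show "(\<lambda>(V0, E0). ev V0 E0 k) x \<in> (\<lambda>(V0, E0). ev V0 E0 (card V0 + k - n)) ` big"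
          using x span_big by (intro image_eqI[of _ _ x]) (auto split: prod.split)
      qed
    qed (use fin span_ne in auto)
  qed
  have upper: "cutoff_eigenvalue n E sg w mu kappa n \<le> 1/2 * ?Manti"
  proof -
    have S: "sphere_p n mu 2 \<in> genus_family n mu 2 n"
      using signed_graphD(7)[OF G] by (intro sphere_in_genus_family) auto
    have "limit_eigenvalue n E sg w mu n \<le> (SUP h\<in>sphere_p n mu 2. cutoff_form E sg w h)"
      unfolding limit_eigenvalue_def
    \<comment> \<open>The sphere bounds the infimum from above once the suprema are bounded below; 0
      serves, as the cut-off form is nonnegative on nonempty sets \<open>B\<close>.\<close>
    proof (rule cINF_lower[OF _ S], rule bdd_belowI2)
      fix B assume B: "B \<in> genus_family n mu 2 n"
      note BD = genus_familyD[OF B]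
      obtain h where "h \<in> B" using BD(3) n by blast
      then have "0 \<le> cutoff_form E sg w h" using cutoff_form_bounds(1)[OF G] BD(1) by blast
      also have "\<dots> \<le> (SUP h\<in>B. cutoff_form E sg w h)"
        using cSUP_upper[OF \<open>h \<in> B\<close> bdd_above_cutoff_form[OF G BD(1)]] .
      finally show "0 \<le> (SUP h\<in>B. cutoff_form E sg w h)" .
    qed
    also have "\<dots> \<le> 1/2 * ?Manti"
    proof (rule cSUP_least)
      show "sphere_p n mu 2 \<noteq> {}" using genus_familyD(3)[OF S n] .
      fix h assume "h \<in> sphere_p n mu 2"
      then obtain E0 where E0: "E0 \<subseteq> E" "antibalanced {..<n} E0 sg"
        "cutoff_form E sg w h \<le> 1/2 * ev {..<n} E0 n"
        unfolding ev_def using cutoff_form_le_antibalanced_eig[OF G n] by metis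
      have "({..<n}, E0) \<in> anti" using spanI[OF E0(1)] E0(2) by (auto simp: anti_def span_def)
      then have "ev {..<n} E0 n \<le> ?Manti" using fin by (intro Max_ge) force+
      then show "cutoff_form E sg w h \<le> 1/2 * ?Manti" using E0(3) by simp
    qed
    finally show ?thesis using L n by simp
  qed
  \<comment> \<open>This closes the circle: the antibalanced maximum is at most the spanning one,
    which is at most twice the cut-off eigenvalue, which is at most the antibalanced
    maximum.\<close>
  have "?Manti \<le> ?Mspan n"
    using anti_span anti0 fin by (intro Max_mono image_mono) auto
  with upper lower[OF n order.refl]
  have "cutoff_eigenvalue n E sg w mu kappa n = 1/2 * ?Mspan n" "cutoff_eigenvalue n E sg w mu kappa n = 1/2 * ?Manti"
    by linarith+
  with lower[OF k] eq show ?thesis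
    unfolding ev_def big_def span_def anti_def by simp
qed

end
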